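(* Let $A\in\mathbb{R}^{N\times N}$, $B\in\mathbb{R}^{N\times q}$, $x_0\in\mathbb{R}^N$, $T>0$, $x_d\in L^2(0,T;\mathbb{R}^N)$, $Q\in\mathbb{R}^{N\times N}$ symmetric positive semi-definite and $R\in\mathbb{R}^{q\times q}$ symmetric positive definite. There exists a constant $C=C_{[A,B,x_0,Q,R,x_d,T]}$, depending only on $A,B,x_0,Q,R,x_d,T$ (and in particular not on the splitting, the probabilities or the temporal grid), such that the following holds. Let $A=\sum_{m=1}^M A_m$ be any splitting, $(p_\omega)_{\omega=1}^{2^M}$ any probabilities assigned to the subsets of $\{1,\dots,M\}$, and $0=t_0<t_1<\dots<t_K=T$ any temporal grid with maximal spacing $h$, such that (1) $\langle x,A_mx\rangle\le 0$ for all $x\in\mathbb{R}^N$ and all $m\in\{1,\dots,M\}$, and (2) $\sum_{\omega=1}^{2^M}p_\omega=1$ and $\pi_m>0$ for all $m\in\{1,\dots,M\}$. Let $u^*$ be the minimizer of $J$ over $L^2(0,T;\mathbb{R}^q)$ and, for each $\boldsymbol\omega\in\Omega^K$, let $u_h^*(\boldsymbol\omega)$ be the minimizer of $J_h(\boldsymbol\omega,\cdot)$ over $L^2(0,T;\mathbb{R}^q)$. Then $$\mathbb{E}\bigl[|u_h^*-u^*|^2_{L^2(0,T;\mathbb{R}^q)}\bigr]\le C\,h\,\mathrm{Var}[\mathcal{A}].$$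
   Context: $|\cdot|$ is the Euclidean norm and $\|\cdot\|$ the induced operator norm of matrices; $L^2$-norms are built from the Euclidean norm. Randomized splitting. $S_1,\dots,S_{2^M}$ is an enumeration of all subsets of $\{1,\dots,M\}$ (including the empty set); $\Omega=\{1,\dots,2^M\}$. Subset $S_\omega$ is given probability $p_\omega\ge 0$. The probability that index $m$ is selected is $\pi_m=\sum_{\omega:\,m\in S_\omega}p_\omega$. The grid spacings are $h_k=t_k-t_{k-1}$ and $h=\max_k h_k$. For $\boldsymbol\omega=(\omega_1,\dots,\omega_K)\in\Omega^K$ define the piecewise constant matrix $$\mathcal{A}_h(\boldsymbol\omega,t)=\sum_{m\in S_{\omega_k}}\frac{A_m}{\pi_m},\qquad t\in[t_{k-1},t_k).$$ The indices $\omega_k$ are chosen independently, i.e. $\Omega^K$ carries the probabilities $p(\boldsymbol\omega)=p_{\omega_1}p_{\omega_2}\cdots p_{\omega_K}$, and $\mathbb{E}[X]=\sum_{\boldsymbol\omega\in\Omega^K}X(\boldsymbol\omega)p(\boldsymbol\omega)$ (the argument $\boldsymbol\omega$ is suppressed inside $\mathbb{E}$). Further $$\mathrm{Var}[\mathcal{A}]=\sum_{\omega=1}^{2^M}\Bigl\|\sum_{m\in S_\omega}\frac{A_m}{\pi_m}-A\Bigr\|^2p_\omega .$$ Cost functionals. For $u\in L^2(0,T;\mathbb{R}^q)$ let $x$ solve $\dot x=Ax+Bu$, $x(0)=x_0$, and let $x_h(\boldsymbol\omega,\cdot)$ solve $\dot x_h(\boldsymbol\omega,t)=\mathcal{A}_h(\boldsymbol\omega,t)x_h(\boldsymbol\omega,t)+Bu(t)$,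 $x_h(\boldsymbol\omega,0)=x_0$. Define $$J(u)=\tfrac12\int_0^T\bigl((x(t)-x_d(t))^\top Q(x(t)-x_d(t))+u(t)^\top Ru(t)\bigr)\,dt,$$ $$J_h(\boldsymbol\omega,u)=\tfrac12\int_0^T\bigl((x_h(\boldsymbol\omega,t)-x_d(t))^\top Q(x_h(\boldsymbol\omega,t)-x_d(t))+u(t)^\top Ru(t)\bigr)\,dt.$$ Since $R$ is positive definite, the minimizers of $J$ and of $J_h(\boldsymbol\omega,\cdot)$ exist and are unique. *)

theory Defs
  imports "HOL-Analysis.Analysis" "HOL-Library.FuncSet"
begin

(* Elements of L^2(0,T) are represented by square-integrable functions; only their restriction to
   [0,T] matters, and a.e. equal functions are not identified. *)

definition L2 :: "real \<Rightarrow> (real \<Rightarrow> 'a::euclidean_space) set" where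
  "L2 T = {u. u \<in> borel_measurable (lebesgue_on {0..T}) \<and>
              integrable (lebesgue_on {0..T}) (\<lambda>s. (norm (u s))\<^sup>2)}"

definition L2_norm :: "real \<Rightarrow> (real \<Rightarrow> 'a::euclidean_space) \<Rightarrow> real" where
  "L2_norm T u = sqrt (integral\<^sup>L (lebesgue_on {0..T}) (\<lambda>s. (norm (u s))\<^sup>2))"

(* Since u is only square integrable, x' = F x + B u, x(0) = x0, is meant in the sense of
   Caratheodory: x is absolutely continuous and the equation holds almost everywhere, i.e.
   x is the integral of its integrable right-hand side. *)

definition solves_state ::
  "real \<Rightarrow> (real \<Rightarrow> real^'n^'n) \<Rightarrow> real^'q^'n \<Rightarrow> real^'n \<Rightarrow> (real \<Rightarrow> real^'q) \<Rightarrow> (real \<Rightarrow> real^'n) \<Rightarrow> bool"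
  where
  "solves_state T F B x0 u x \<longleftrightarrow>
     integrable (lebesgue_on {0..T}) (\<lambda>s. F s *v x s + B *v u s) \<and>
     (\<forall>t\<in>{0..T}. x t = x0 + integral\<^sup>L (lebesgue_on {0..t}) (\<lambda>s. F s *v x s + B *v u s))"

(* All solutions agree on [0,T], so the choice only concerns irrelevant values outside [0,T]. *)

definition state ::
  "real \<Rightarrow> (real \<Rightarrow> real^'n^'n) \<Rightarrow> real^'q^'n \<Rightarrow> real^'n \<Rightarrow> (real \<Rightarrow> real^'q) \<Rightarrow> real \<Rightarrow> real^'n"
  where
  "state T F B x0 u = (SOME x. solves_state T F B x0 u x)"

(* J is the case F = (\<lambda>_. A), and J_h(\<omega>, -) is the case F = split_matrix ... \<omega>. *)

definition cost ::
  "real \<Rightarrow> (real \<Rightarrow> real^'n^'n) \<Rightarrow> real^'q^'n \<Rightarrow> real^'n \<Rightarrow> (real \<Rightarrow> real^'n) \<Rightarrow>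
   real^'n^'n \<Rightarrow> real^'q^'q \<Rightarrow> (real \<Rightarrow> real^'q) \<Rightarrow> real"
  where
  "cost T F B x0 xd Q R u =
     (1/2) * integral\<^sup>L (lebesgue_on {0..T})
       (\<lambda>s. (state T F B x0 u s - xd s) \<bullet> (Q *v (state T F B x0 u s - xd s)) + u s \<bullet> (R *v u s))"

definition subset_enumeration :: "nat \<Rightarrow> (nat \<Rightarrow> nat set) \<Rightarrow> bool" where
  "subset_enumeration M S \<longleftrightarrow> bij_betw S {1..2^M} (Pow {1..M})"

definition selection_prob :: "nat \<Rightarrow> (nat \<Rightarrow> nat set) \<Rightarrow> (nat \<Rightarrow> real) \<Rightarrow> nat \<Rightarrow> real" where
  "selection_prob M S p m = (\<Sum>\<omega> | \<omega> \<in> {1..2^M} \<and> m \<in> S \<omega>. p \<omega>)"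

definition selected_sum ::
  "nat \<Rightarrow> (nat \<Rightarrow> real^'n^'n) \<Rightarrow> (nat \<Rightarrow> nat set) \<Rightarrow> (nat \<Rightarrow> real) \<Rightarrow> nat \<Rightarrow> real^'n^'n" where
  "selected_sum M Am S p \<omega> = (\<Sum>m\<in>S \<omega>. (1 / selection_prob M S p m) *\<^sub>R Am m)"

(* On [t_{k-1}, t_k) exactly the k-th summand is nonzero; the value at t = T is irrelevant. *)

definition split_matrix ::
  "nat \<Rightarrow> (nat \<Rightarrow> real^'n^'n) \<Rightarrow> (nat \<Rightarrow> nat set) \<Rightarrow> (nat \<Rightarrow> real) \<Rightarrow> nat \<Rightarrow> (nat \<Rightarrow> real) \<Rightarrow>
   (nat \<Rightarrow> nat) \<Rightarrow> real \<Rightarrow> real^'n^'n" where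
  "split_matrix M Am S p K t \<omega> s =
     (\<Sum>k=1..K. if t (k-1) \<le> s \<and> s < t k then selected_sum M Am S p (\<omega> k) else 0)"

definition time_grid :: "real \<Rightarrow> nat \<Rightarrow> (nat \<Rightarrow> real) \<Rightarrow> bool" where
  "time_grid T K t \<longleftrightarrow> t 0 = 0 \<and> t K = T \<and> (\<forall>k\<in>{1..K}. t (k-1) < t k)"

definition max_spacing :: "nat \<Rightarrow> (nat \<Rightarrow> real) \<Rightarrow> real" where
  "max_spacing K t = Max ((\<lambda>k. t k - t (k-1)) ` {1..K})"

definition sample_space :: "nat \<Rightarrow> nat \<Rightarrow> (nat \<Rightarrow> nat) set" where
  "sample_space M K = {1..K} \<rightarrow>\<^sub>E {1..2^M}"

definition expect :: "nat \<Rightarrow> (nat \<Rightarrow> real) \<Rightarrow> nat \<Rightarrow> ((nat \<Rightarrow> nat) \<Rightarrow> real) \<Rightarrow> real" where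
  "expect M p K X = (\<Sum>\<omega>\<in>sample_space M K. X \<omega> * (\<Prod>k=1..K. p (\<omega> k)))"

(* "norm" on matrices is the Frobenius norm, hence onorm. *)

definition splitting_variance ::
  "nat \<Rightarrow> (nat \<Rightarrow> real^'n^'n) \<Rightarrow> (nat \<Rightarrow> nat set) \<Rightarrow> (nat \<Rightarrow> real) \<Rightarrow> real^'n^'n \<Rightarrow> real" where
  "splitting_variance M Am S p A =
     (\<Sum>\<omega>=1..2^M. (onorm ((*v) (selected_sum M Am S p \<omega> - A)))\<^sup>2 * p \<omega>)"

end

theory Submission
  imports Defs
begin

text \<open>
Let \<open>x\<close> and \<open>x\<^sub>h\<close> be the states of the exact and of the randomized system for the same, deterministic
control \<open>u\<^sup>*\<close>, and let \<open>\<phi>\<close> and \<open>\<phi>\<^sub>h\<close> solve the two adjoint equations with the same deterministic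
right-hand side \<open>Q (x - x\<^sub>d)\<close>. Subtracting the two optimality conditions and using the coercivity of \<open>R\<close>
bounds \<open>|u\<^sub>h\<^sup>* - u\<^sup>*|\<close>, sample by sample, by a multiple of \<open>|x\<^sub>h - x| + |\<phi>\<^sub>h - \<phi>|\<close> in the norm of \<open>L\<^sup>2\<close>
(lemma \<open>control_error\<close>). It is essential that neither the control in these states nor the right-hand
side in these adjoint states is random.

Both differences solve a linear equation with a dissipative random coefficient \<open>G\<close>, start at zero (the
adjoint one after reversing time), and are driven by \<open>(G - D) \<xi>\<close> with a deterministic bounded \<open>\<xi>\<close>, where
\<open>D\<close> is the mean of \<open>G\<close> on each grid cell. For such a process \<open>y\<close>, lemma \<open>random_perturbation_estimate\<close> gives
\<open>E |y(t)|\<^sup>2 \<le> const * h * Var\<close>: energy is only fed in through \<open>y \<bullet> (G - D) \<xi>\<close>, the value of \<open>y\<close> at the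
beginning of a cell is independent of the index drawn there and averages out, and the change of \<open>y\<close> within
a cell is proportional to \<open>h\<close>.

Apart from the data, the constants involve only bounds of \<open>x, x\<^sub>h, \<phi>, \<phi>\<^sub>h\<close>. By dissipativity (lemma \<open>dissipative_bound\<close>) these do
not depend on the size of the coefficient, hence not on the splitting, and \<open>u\<^sup>*\<close> itself is bounded by the
cost of the zero control (lemma \<open>minimizer_L2_bound\<close>).

As the data are only square integrable, all equations are understood as integral equations. The tools for
them are the product rule for primitives (lemma \<open>primitive_on_inner\<close>), existence by a contraction
argument (lemma \<open>linear_ode_exists\<close>) and a duality relation (lemma \<open>adjoint_duality\<close>).
\<close>

section \<open>Matrices and integrals over intervals\<close>

lemma bounded_bilinear_matrix_vector_mult:
  "bounded_bilinear ((*v) :: real^'n^'m \<Rightarrow> real^'n \<Rightarrow> real^'m)"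
  unfolding bilinear_conv_bounded_bilinear[symmetric] bilinear_def
  by (auto intro!: linearI simp: matrix_vector_mult_add_rdistrib matrix_vector_right_distrib
      scaleR_matrix_vector_assoc matrix_vector_mult_scaleR)

lemma inner_transpose: "(transpose M *v x) \<bullet> y = x \<bullet> (M *v y)"
  for M :: "real^'n^'m"
  by (metis dot_lmul_matrix inner_commute vector_transpose_matrix transpose_transpose)

lemma norm_matrix_vector_le: "norm (M *v x) \<le> onorm ((*v) M) * norm x" for M :: "real^'n^'m"
  by (rule onorm) simp

lemma onorm_matrix_nonneg: "0 \<le> onorm ((*v) M)" for M :: "real^'n^'m"
  by (rule onorm_pos_le) simp

text \<open>
From \<open>|M\<^sup>T x|\<^sup>2 = x \<bullet> M (M\<^sup>T x)\<close> and the Cauchy-Schwarz inequality; it transfers the variance to the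
transposed matrices of the adjoint equation.
\<close>

lemma norm_transpose_vector_le: "norm (transpose M *v x) \<le> onorm ((*v) M) * norm x"
  for M :: "real^'n^'m"
proof -
  let ?y = "transpose M *v x"
  have "norm ?y * norm ?y = x \<bullet> (M *v ?y)"
    by (metis inner_transpose power2_norm_eq_inner power2_eq_square)
  also have "\<dots> \<le> norm x * (onorm ((*v) M) * norm ?y)"
    by (rule order_trans[OF norm_cauchy_schwarz]) (intro mult_left_mono norm_matrix_vector_le, auto)
  finally have "norm ?y * norm ?y \<le> (onorm ((*v) M) * norm x) * norm ?y" by (simp add: ac_simps)
  then show ?thesis
    by (cases "norm ?y = 0") (auto simp: onorm_matrix_nonneg mult_le_cancel_right)
qed

lemma integrable_bounded_measurable:
  fixes f :: "real \<Rightarrow> 'a::euclidean_space"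
  assumes "f \<in> borel_measurable (lebesgue_on {a..b})" "\<And>s. s \<in> {a..b} \<Longrightarrow> norm (f s) \<le> c"
  shows "integrable (lebesgue_on {a..b}) f"
proof -
  interpret finite_measure "lebesgue_on {a..b}" by (rule finite_measure_lebesgue_on) simp
  show ?thesis by (rule integrable_const_bound[of _ c]) (use assms in auto)
qed

lemma continuous_bounded_interval:
  fixes f :: "real \<Rightarrow> 'a::euclidean_space"
  assumes "continuous_on {a..b} f"
  obtains c where "\<And>s. s \<in> {a..b} \<Longrightarrow> norm (f s) \<le> c"
  using compact_imp_bounded[OF compact_continuous_image[OF assms compact_Icc]]
  unfolding bounded_iff by blast

lemma measurable_continuous_interval:
  fixes f :: "real \<Rightarrow> 'a::euclidean_space"
  assumes "continuous_on {a..b} f"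
  shows "f \<in> borel_measurable (lebesgue_on {a..b})"
  using continuous_imp_measurable_on_sets_lebesgue[OF assms] by simp

lemma integrable_inner_continuous:
  fixes f g :: "real \<Rightarrow> 'a::euclidean_space"
  assumes f: "integrable (lebesgue_on {a..b}) f" and g: "continuous_on {a..b} g"
  shows "integrable (lebesgue_on {a..b}) (\<lambda>s. f s \<bullet> g s)"
proof -
  obtain c where c: "\<And>s. s \<in> {a..b} \<Longrightarrow> norm (g s) \<le> c"
    using continuous_bounded_interval[OF g] by blast
  note [measurable] = measurable_continuous_interval[OF g] borel_measurable_integrable[OF f]
  show ?thesis
  proof (rule Bochner_Integration.integrable_bound[OF integrable_mult_right[OF integrable_norm[OF f], of c]])
    show "AE s in lebesgue_on {a..b}. norm (f s \<bullet> g s) \<le> norm (c * norm (f s))"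
    proof (rule AE_I2)
      fix s assume "s \<in> space (lebesgue_on {a..b})"
      then have "norm (g s) \<le> c" using c by auto
      then have "norm (f s) * norm (g s) \<le> \<bar>c\<bar> * norm (f s)"
        by (subst mult.commute) (intro mult_right_mono, auto)
      then show "norm (f s \<bullet> g s) \<le> norm (c * norm (f s))"
        using Cauchy_Schwarz_ineq2[of "f s" "g s"] by (simp add: abs_mult)
    qed
  qed measurable
qed

lemma integral_mono_interval:
  fixes f :: "real \<Rightarrow> real"
  assumes "integrable (lebesgue_on {a..b}) f" "{c..d} \<subseteq> {a..b}" "\<And>s. s \<in> {a..b} \<Longrightarrow> 0 \<le> f s"
  shows "(LINT s|lebesgue_on {c..d}. f s) \<le> (LINT s|lebesgue_on {a..b}. f s)"
  by (rule integral_mono_lebesgue_on_AE) (use assms in auto)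

lemma integral_split:
  fixes f :: "real \<Rightarrow> 'a::euclidean_space"
  assumes f: "integrable (lebesgue_on {a..c}) f" and "a \<le> b" "b \<le> c"
  shows "(LINT s|lebesgue_on {a..c}. f s) = (LINT s|lebesgue_on {a..b}. f s) + (LINT s|lebesgue_on {b..c}. f s)"
proof -
  have i: "integrable (lebesgue_on {a..b}) f" "integrable (lebesgue_on {b..c}) f"
    by (rule integrable_subinterval[OF f], use assms in simp)+
  show ?thesis
    using Henstock_Kurzweil_Integration.integral_combine[OF assms(2,3) integrable_on_lebesgue_on[OF f]] f i
    by (simp add: lebesgue_integral_eq_integral)
qed

lemma
  fixes f :: "real \<Rightarrow> 'a::euclidean_space"
  assumes f: "integrable (lebesgue_on {a..b}) f"
  shows integrable_reflect: "integrable (lebesgue_on {c-b..c-a}) (\<lambda>s. f (c - s))"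
    and integral_reflect: "(LINT s|lebesgue_on {c-b..c-a}. f (c - s)) = (LINT s|lebesgue_on {a..b}. f s)"
proof -
  have "has_bochner_integral lebesgue (\<lambda>s. indicator {a..b} s *\<^sub>R f s) (LINT s|lebesgue_on {a..b}. f s)"
    using f by (subst has_bochner_integral_restrict_space[symmetric]) (auto simp: has_bochner_integral_iff)
  then have "has_bochner_integral lebesgue (\<lambda>s. indicator {a..b} (c + (-1) * s) *\<^sub>R f (c + (-1) * s))
     (LINT s|lebesgue_on {a..b}. f s)"
    using has_bochner_integral_lebesgue_real_affine_iff[of "-1" "\<lambda>s. indicator {a..b} s *\<^sub>R f s" _ c] by simp
  moreover have "(\<lambda>s. indicator {a..b} (c + (-1) * s) *\<^sub>R f (c + (-1) * s))
      = (\<lambda>s. indicator {c-b..c-a} s *\<^sub>R f (c - s))"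
    by (rule ext) (auto simp: indicator_def)
  ultimately have "has_bochner_integral lebesgue (\<lambda>s. indicator {c-b..c-a} s *\<^sub>R f (c - s))
     (LINT s|lebesgue_on {a..b}. f s)" by simp
  then have "has_bochner_integral (lebesgue_on {c-b..c-a}) (\<lambda>s. f (c - s)) (LINT s|lebesgue_on {a..b}. f s)"
    by (subst has_bochner_integral_restrict_space) auto
  then show "integrable (lebesgue_on {c-b..c-a}) (\<lambda>s. f (c - s))"
    "(LINT s|lebesgue_on {c-b..c-a}. f (c - s)) = (LINT s|lebesgue_on {a..b}. f s)"
    by (auto simp: has_bochner_integral_iff)
qed

lemma AE_interior: "AE s in lebesgue_on {a..b::real}. a < s \<and> s < b"
proof -
  have "{a, b} \<inter> {a..b} \<in> null_sets lebesgue"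
    using negligible_subset[of "{a, b}" "{a, b} \<inter> {a..b}"]
    by (simp flip: negligible_iff_null_sets)
  then have "{a, b} \<inter> {a..b} \<in> null_sets (lebesgue_on {a..b})"
    by (subst null_sets_restrict_space) auto
  then show ?thesis by (rule AE_I') auto
qed

lemma integral_mono_interior:
  fixes f g :: "real \<Rightarrow> real"
  assumes "integrable (lebesgue_on {a..b}) f" "integrable (lebesgue_on {a..b}) g"
    and "\<And>s. a < s \<Longrightarrow> s < b \<Longrightarrow> f s \<le> g s"
  shows "(LINT s|lebesgue_on {a..b}. f s) \<le> (LINT s|lebesgue_on {a..b}. g s)"
  by (rule integral_mono_AE[OF assms(1,2)], rule AE_mp[OF AE_interior]) (use assms(3) in auto)

lemma integral_le_interior:
  fixes f :: "real \<Rightarrow> real"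
  assumes "integrable (lebesgue_on {a..b}) f" "\<And>s. a < s \<Longrightarrow> s < b \<Longrightarrow> f s \<le> c" "a \<le> b"
  shows "(LINT s|lebesgue_on {a..b}. f s) \<le> (b - a) * c"
proof -
  have "integrable (lebesgue_on {a..b}) (\<lambda>_. c)" by (intro continuous_imp_integrable_real continuous_intros)
  from integral_mono_interior[OF assms(1) this assms(2)] show ?thesis
    using assms(3) by (simp add: measure_restrict_space)
qed

lemma integral_Cauchy_Schwarz:
  fixes f g :: "real \<Rightarrow> real"
  assumes f: "integrable N (\<lambda>s. (f s)\<^sup>2)" and g: "integrable N (\<lambda>s. (g s)\<^sup>2)"
    and fg: "integrable N (\<lambda>s. f s * g s)"
  shows "(LINT s|N. f s * g s)\<^sup>2 \<le> (LINT s|N. (f s)\<^sup>2) * (LINT s|N. (g s)\<^sup>2)"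
proof -
  let ?a = "LINT s|N. (f s)\<^sup>2" and ?b = "LINT s|N. f s * g s" and ?c = "LINT s|N. (g s)\<^sup>2"
  have quad: "0 \<le> ?a - 2 * l * ?b + l\<^sup>2 * ?c" for l
  proof -
    have "0 \<le> (LINT s|N. (f s - l * g s)\<^sup>2)" by simp
    also have "(\<lambda>s. (f s - l * g s)\<^sup>2) = (\<lambda>s. (f s)\<^sup>2 - (2 * l) * (f s * g s) + l\<^sup>2 * (g s)\<^sup>2)"
      by (simp add: fun_eq_iff power2_eq_square algebra_simps)
    also have "(LINT s|N. \<dots> s) = ?a - 2 * l * ?b + l\<^sup>2 * ?c"
      using f g fg by simp
    finally show ?thesis .
  qed
  have c: "0 \<le> ?c" and a: "0 \<le> ?a" by simp_all
  show ?thesis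
  proof (cases "?c = 0")
    case True
    have "?b = 0"
    proof (rule ccontr)
      assume "?b \<noteq> 0"
      then show False using quad[of "(?a + 1) / (2 * ?b)"] a by (simp only: True) (simp add: field_simps)
    qed
    then show ?thesis using True by simp
  next
    case False
    then have "0 < ?c" using c by linarith
    then show ?thesis using quad[of "?b / ?c"] by (simp add: field_simps power2_eq_square)
  qed
qed

section \<open>Primitives\<close>

text \<open>
Absolute continuity on \<open>{0..T}\<close> in the form used throughout: \<open>x\<close> is continuous, with almost
everywhere derivative \<open>g\<close>. The initial value is left free, so that sums and multiples of
primitives are primitives.
\<close>

definition primitive_on :: "real \<Rightarrow> (real \<Rightarrow> 'a::euclidean_space) \<Rightarrow> (real \<Rightarrow> 'a) \<Rightarrow> bool" where
  "primitive_on T g x \<longleftrightarrow> integrable (lebesgue_on {0..T}) g \<and>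
     (\<forall>t\<in>{0..T}. x t = x 0 + (LINT s|lebesgue_on {0..t}. g s))"

text \<open>
The value at \<open>0\<close> is forced to be \<open>c\<close>, because the integral over the one-point interval vanishes.
\<close>

lemma primitive_onI:
  assumes "integrable (lebesgue_on {0..T}) g"
    "\<And>t. t \<in> {0..T} \<Longrightarrow> x t = c + (LINT s|lebesgue_on {0..t}. g s)"
  shows "primitive_on T g x" 
proof (cases "0 \<le> T")
  case True
  have "{0} \<in> null_sets lebesgue" by (simp flip: negligible_iff_null_sets)
  then have "(LINT s|lebesgue_on {0..0}. g s) = 0" by (simp add: integral_eq_zero_null_sets)
  with True have c: "x 0 = c" using assms(2)[of 0] by auto
  show ?thesis unfolding primitive_on_def c using assms by blast
next
  case False
  then have "{0..T} = {}" by simp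
  with assms show ?thesis unfolding primitive_on_def by blast
qed

lemma primitive_on_integrable: "primitive_on T g x \<Longrightarrow> integrable (lebesgue_on {0..T}) g"
  by (simp add: primitive_on_def)

lemma primitive_on_eq:
  "primitive_on T g x \<Longrightarrow> t \<in> {0..T} \<Longrightarrow> x t = x 0 + (LINT s|lebesgue_on {0..t}. g s)"
  unfolding primitive_on_def by blast

lemma primitive_on_subset: "primitive_on T g x \<Longrightarrow> a \<le> T \<Longrightarrow> primitive_on a g x"
  unfolding primitive_on_def using integrable_subinterval[of 0 T g 0 a]
  by (metis atLeastAtMost_iff order_trans atLeastatMost_subset_iff order_refl)

lemma primitive_on_continuous:
  assumes "primitive_on T g x"
  shows "continuous_on {0..T} x"
proof -
  have "continuous_on {0..T} (\<lambda>t. x 0 + (LINT s|lebesgue_on {0..t}. g s))"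
    by (intro continuous_intros indefinite_integral_continuous_real primitive_on_integrable[OF assms])
  moreover have "continuous_on {0..T} x \<longleftrightarrow> continuous_on {0..T} (\<lambda>t. x 0 + (LINT s|lebesgue_on {0..t}. g s))"
    by (rule continuous_on_cong[OF refl primitive_on_eq[OF assms]])
  ultimately show ?thesis by blast
qed

lemma primitive_on_increment:
  assumes "primitive_on T g x" "0 \<le> a" "a \<le> b" "b \<le> T"
  shows "x b - x a = (LINT s|lebesgue_on {a..b}. g s)"
proof -
  have "integrable (lebesgue_on {0..b}) g"
    using primitive_on_integrable[OF primitive_on_subset[OF assms(1,4)]] .
  from integral_split[OF this assms(2,3)] show ?thesis
    using primitive_on_eq[OF assms(1), of a] primitive_on_eq[OF assms(1), of b] assms by auto
qed

lemma primitive_on_add: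
  assumes "primitive_on T g x" "primitive_on T g' x'"
  shows "primitive_on T (\<lambda>s. g s + g' s) (\<lambda>s. x s + x' s)"
proof (rule primitive_onI[where c = "x 0 + x' 0"])
  show "x t + x' t = x 0 + x' 0 + (LINT s|lebesgue_on {0..t}. g s + g' s)" if "t \<in> {0..T}" for t
  proof -
    have "integrable (lebesgue_on {0..t}) g" "integrable (lebesgue_on {0..t}) g'"
      using primitive_on_integrable[OF primitive_on_subset[of T _ _ t]] assms that by auto
    then show ?thesis
      using primitive_on_eq[OF assms(1) that] primitive_on_eq[OF assms(2) that] by simp
  qed
qed (use assms[THEN primitive_on_integrable] in simp)

lemma primitive_on_scaleR:
  assumes "primitive_on T g x"
  shows "primitive_on T (\<lambda>s. c *\<^sub>R g s) (\<lambda>s. c *\<^sub>R x s)"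
proof (rule primitive_onI[where c = "c *\<^sub>R x 0"])
  show "c *\<^sub>R x t = c *\<^sub>R x 0 + (LINT s|lebesgue_on {0..t}. c *\<^sub>R g s)" if "t \<in> {0..T}" for t
    using arg_cong[OF primitive_on_eq[OF assms(1) that], of "\<lambda>v. c *\<^sub>R v"] by (simp add: algebra_simps)
qed (use assms[THEN primitive_on_integrable] in simp)

lemma primitive_on_diff:
  assumes "primitive_on T g x" "primitive_on T g' x'"
  shows "primitive_on T (\<lambda>s. g s - g' s) (\<lambda>s. x s - x' s)"
  using primitive_on_add[OF assms(1) primitive_on_scaleR[OF assms(2), of "-1"]] by simp

lemma primitive_on_cong:
  assumes "primitive_on T g x" "\<And>s. s \<in> {0..T} \<Longrightarrow> g' s = g s" "\<And>s. s \<in> {0..T} \<Longrightarrow> x' s = x s"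
  shows "primitive_on T g' x'"
proof (rule primitive_onI[where c = "x 0"])
  show "integrable (lebesgue_on {0..T}) g'"
    using primitive_on_integrable[OF assms(1)] assms(2)
    by (subst Bochner_Integration.integrable_cong[of _ _ _ g]) auto
  show "x' t = x 0 + (LINT s|lebesgue_on {0..t}. g' s)" if "t \<in> {0..T}" for t
  proof -
    have "(LINT s|lebesgue_on {0..t}. g' s) = (LINT s|lebesgue_on {0..t}. g s)"
      by (rule Bochner_Integration.integral_cong) (use that assms(2) in auto)
    then show ?thesis using primitive_on_eq[OF assms(1) that] assms(3)[OF that] by simp
  qed
qed

lemma primitive_on_reflect:
  assumes x: "primitive_on T g x" 
  shows "primitive_on T (\<lambda>s. - g (T - s)) (\<lambda>s. x (T - s))"
proof (rule primitive_onI[where c = "x T"])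
  show "integrable (lebesgue_on {0..T}) (\<lambda>s. - g (T - s))"
    using integrable_reflect[OF primitive_on_integrable[OF x], of T] by simp
  show "x (T - t) = x T + (LINT s|lebesgue_on {0..t}. - g (T - s))" if t: "t \<in> {0..T}" for t
  proof -
    have "integrable (lebesgue_on {T-t..T}) g"
      by (rule integrable_subinterval[OF primitive_on_integrable[OF x]]) (use t in auto)
    then show ?thesis
      using primitive_on_increment[OF x, of "T - t" T] t integral_reflect[of "T-t" T g T]
      by (simp add: algebra_simps)
  qed
qed

text \<open>
The square \<open>[0,T] \<times> [0,T]\<close> is cut along its diagonal. One half is closed and the other one open,
so no part is counted twice, and the half-open inner integral differs from the closed one by a null
set.
\<close>

lemma Fubini_triangle:
  fixes f g :: "real \<Rightarrow> 'a::euclidean_space"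
  assumes f: "integrable (lebesgue_on {0..T}) f" and g: "integrable (lebesgue_on {0..T}) g"
  shows "(LINT s|lebesgue_on {0..T}. f s) \<bullet> (LINT s|lebesgue_on {0..T}. g s) =
    (LINT s|lebesgue_on {0..T}. f s \<bullet> (LINT r|lebesgue_on {0..s}. g r)) +
    (LINT s|lebesgue_on {0..T}. (LINT r|lebesgue_on {0..s}. f r) \<bullet> g s)"
proof -
  let ?M = "lebesgue_on {0..T}"
  interpret finite_measure ?M by (rule finite_measure_lebesgue_on) simp
  interpret pair_sigma_finite ?M ?M ..
  note [measurable] = borel_measurable_integrable[OF f] borel_measurable_integrable[OF g]
  have id [measurable]: "(\<lambda>s. s) \<in> borel_measurable ?M"
    by (rule measurable_continuous_interval) (rule continuous_on_id)
  define k where "k P s r = (if P s r then f s \<bullet> g r else 0)" for P s r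
  have int: "integrable (?M \<Otimes>\<^sub>M ?M) (case_prod (k P))" 
    if [measurable]: "Measurable.pred (?M \<Otimes>\<^sub>M ?M) (\<lambda>z. P (fst z) (snd z))" for P
  proof (rule Bochner_Integration.integrable_bound)
    show "integrable (?M \<Otimes>\<^sub>M ?M) (\<lambda>z. norm (f (fst z)) * norm (g (snd z)))"
      by (rule Fubini_integrable) (use f g in \<open>auto simp: abs_mult\<close>)
    show "case_prod (k P) \<in> borel_measurable (?M \<Otimes>\<^sub>M ?M)"
      unfolding k_def case_prod_beta by measurable
    show "AE z in ?M \<Otimes>\<^sub>M ?M. norm (case_prod (k P) z) \<le> norm (norm (f (fst z)) * norm (g (snd z)))"
      by (auto simp: k_def case_prod_beta abs_mult Cauchy_Schwarz_ineq2)
  qed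
  have T: "integrable (?M \<Otimes>\<^sub>M ?M) (case_prod (k (\<lambda>_ _. True)))" by (rule int) simp
  have L: "integrable (?M \<Otimes>\<^sub>M ?M) (case_prod (k (\<lambda>s r. r \<le> s)))" by (rule int) measurable
  have G: "integrable (?M \<Otimes>\<^sub>M ?M) (case_prod (k (\<lambda>s r. s < r)))" by (rule int) measurable
  have res: "integrable ?M (\<lambda>r. if r \<in> {0..s} then u r else 0)"
    if "integrable ?M u" "s \<in> {0..T}" for u :: "real \<Rightarrow> 'a" and s
  proof -
    have "{0..s} \<in> sets ?M" using that(2) by (subst sets_restrict_space_iff) auto
    from integrable_mult_indicator[OF this that(1)] show ?thesis
      by (simp add: indicator_scaleR_eq_if)
  qed
  have "integral\<^sup>L (?M \<Otimes>\<^sub>M ?M) (case_prod (k (\<lambda>_ _. True)))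
      = integral\<^sup>L (?M \<Otimes>\<^sub>M ?M) (\<lambda>z. case_prod (k (\<lambda>s r. r \<le> s)) z + case_prod (k (\<lambda>s r. s < r)) z)"
    by (rule Bochner_Integration.integral_cong) (auto simp: k_def)
  also have "\<dots> = integral\<^sup>L (?M \<Otimes>\<^sub>M ?M) (case_prod (k (\<lambda>s r. r \<le> s)))
      + integral\<^sup>L (?M \<Otimes>\<^sub>M ?M) (case_prod (k (\<lambda>s r. s < r)))"
    using L G by simp
  also have "integral\<^sup>L (?M \<Otimes>\<^sub>M ?M) (case_prod (k (\<lambda>s r. r \<le> s)))
      = (LINT s|?M. f s \<bullet> (LINT r|lebesgue_on {0..s}. g r))"
    unfolding integral_fst[OF L, symmetric]
  proof (rule Bochner_Integration.integral_cong)
    fix s assume s: "s \<in> space ?M"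
    have "(LINT r|?M. k (\<lambda>s r. r \<le> s) s r) = (LINT r|?M. f s \<bullet> (if r \<in> {0..s} then g r else 0))"
      by (rule Bochner_Integration.integral_cong) (auto simp: k_def)
    also have "\<dots> = f s \<bullet> (LINT r|?M. (if r \<in> {0..s} then g r else 0))"
      by (rule integral_inner_right)
         (use res[OF g] s in auto)
    also have "(LINT r|?M. (if r \<in> {0..s} then g r else 0)) = (LINT r|lebesgue_on {0..s}. g r)"
      by (rule Lebesgue_Measure.integral_restrict) (use s in auto)
    finally show "(LINT r|?M. k (\<lambda>s r. r \<le> s) s r) = f s \<bullet> (LINT r|lebesgue_on {0..s}. g r)" .
  qed simp
  also have "integral\<^sup>L (?M \<Otimes>\<^sub>M ?M) (case_prod (k (\<lambda>s r. s < r)))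
      = (LINT r|?M. (LINT s|lebesgue_on {0..r}. f s) \<bullet> g r)"
    unfolding integral_snd[OF G, symmetric]
  proof (rule Bochner_Integration.integral_cong)
    fix r assume r: "r \<in> space ?M"
    have r': "0 \<le> r" "r \<le> T" using r by auto
    have "AE s in ?M. s \<noteq> r"
      by (auto intro!: AE_I'[of "{r}"] simp: null_sets_restrict_space r' simp flip: negligible_iff_null_sets)
    then have "(LINT s|?M. k (\<lambda>s r. s < r) s r) = (LINT s|?M. (if s \<in> {0..r} then f s else 0) \<bullet> g r)"
    proof (intro Bochner_Integration.integral_cong_AE)
      show "AE s in ?M. k (\<lambda>s r. s < r) s r = (if s \<in> {0..r} then f s else 0) \<bullet> g r"
        using \<open>AE s in ?M. s \<noteq> r\<close> AE_space by eventually_elim (auto simp: k_def)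
    qed (auto simp: k_def)
    also have "\<dots> = (LINT s|?M. (if s \<in> {0..r} then f s else 0)) \<bullet> g r"
      by (rule integral_inner_left)
         (use res[OF f] r in auto)
    also have "(LINT s|?M. (if s \<in> {0..r} then f s else 0)) = (LINT s|lebesgue_on {0..r}. f s)"
      by (rule Lebesgue_Measure.integral_restrict) (use r in auto)
    finally show "(LINT s|?M. k (\<lambda>s r. s < r) s r) = (LINT s|lebesgue_on {0..r}. f s) \<bullet> g r" .
  qed simp
  finally show ?thesis
    unfolding integral_fst[OF T, symmetric] unfolding k_def if_True
    by (simp only: integral_inner_right[OF g] integral_inner_left[OF f])
qed

text \<open>
The product rule for absolutely continuous functions. Controls and targets are only square
integrable, so the states have merely an integrable derivative and the classical rule for
differentiable functions is not applicable; Fubini's theorem on a triangle replaces it.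
\<close>

lemma primitive_on_inner:
  assumes f: "primitive_on T f' f" and g: "primitive_on T g' g"
  shows "primitive_on T (\<lambda>s. f' s \<bullet> g s + f s \<bullet> g' s) (\<lambda>s. f s \<bullet> g s)"
proof -
  have i: "integrable (lebesgue_on {0..t}) (\<lambda>s. f' s \<bullet> g s)" "integrable (lebesgue_on {0..t}) (\<lambda>s. f s \<bullet> g' s)"
    if "primitive_on t f' f" "primitive_on t g' g" for t
    using integrable_inner_continuous[OF primitive_on_integrable[OF that(1)] primitive_on_continuous[OF that(2)]]
     integrable_inner_continuous[OF primitive_on_integrable[OF that(2)] primitive_on_continuous[OF that(1)]]
    by (simp_all add: inner_commute)
  show ?thesis
  proof (rule primitive_onI[where c = "f 0 \<bullet> g 0"])
    fix t assume t: "t \<in> {0..T}"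
    let ?F = "\<lambda>s. LINT r|lebesgue_on {0..s}. f' r" and ?G = "\<lambda>s. LINT r|lebesgue_on {0..s}. g' r"
    have ft: "primitive_on t f' f" and gt: "primitive_on t g' g"
      using primitive_on_subset[OF f] primitive_on_subset[OF g] t by auto
    note fi = primitive_on_integrable[OF ft] and gi = primitive_on_integrable[OF gt]
    note cF = indefinite_integral_continuous_real[OF fi] and cG = indefinite_integral_continuous_real[OF gi]
    have "(LINT s|lebesgue_on {0..t}. f' s \<bullet> g s) = (LINT s|lebesgue_on {0..t}. f' s \<bullet> g 0 + f' s \<bullet> ?G s)"
      by (intro Bochner_Integration.integral_cong refl)
         (simp flip: inner_add_right primitive_on_eq[OF gt])
    also have "\<dots> = ?F t \<bullet> g 0 + (LINT s|lebesgue_on {0..t}. f' s \<bullet> ?G s)"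
      using fi integrable_inner_continuous[OF fi cG] by simp
    finally have 1: "(LINT s|lebesgue_on {0..t}. f' s \<bullet> g s) = \<dots>" .
    have "(LINT s|lebesgue_on {0..t}. f s \<bullet> g' s) = (LINT s|lebesgue_on {0..t}. f 0 \<bullet> g' s + ?F s \<bullet> g' s)"
      by (intro Bochner_Integration.integral_cong refl)
         (simp flip: inner_add_left primitive_on_eq[OF ft])
    also have "\<dots> = f 0 \<bullet> ?G t + (LINT s|lebesgue_on {0..t}. ?F s \<bullet> g' s)"
      using gi integrable_inner_continuous[OF gi cF] by (simp add: inner_commute)
    finally have 2: "(LINT s|lebesgue_on {0..t}. f s \<bullet> g' s) = \<dots>" .
    have "f t = f 0 + ?F t" "g t = g 0 + ?G t" by (fact primitive_on_eq[OF f t], fact primitive_on_eq[OF g t])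
    then show "f t \<bullet> g t = f 0 \<bullet> g 0 + (LINT s|lebesgue_on {0..t}. f' s \<bullet> g s + f s \<bullet> g' s)"
      using i[OF ft gt] 1 2 Fubini_triangle[OF fi gi] by (simp add: inner_add_left inner_add_right)
  qed (use i[OF f g] in auto)
qed

section \<open>Linear differential equations with dissipative coefficients\<close>

text \<open>
The regularity of the coefficient that the linear theory below needs. Both the constant matrix
and the piecewise constant ones have it, and so do their transposed time reversals.
\<close>

definition bounded_coeff :: "real \<Rightarrow> (real \<Rightarrow> real^'n^'n) \<Rightarrow> bool" where
  "bounded_coeff T F \<longleftrightarrow> F \<in> borel_measurable (lebesgue_on {0..T}) \<and>
     (\<exists>L. \<forall>s\<in>{0..T}. \<forall>v. norm (F s *v v) \<le> L * norm v)"

definition dissipative_on :: "real \<Rightarrow> (real \<Rightarrow> real^'n^'n) \<Rightarrow> bool" where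
  "dissipative_on T F \<longleftrightarrow> (\<forall>s\<in>{0..T}. \<forall>v. v \<bullet> (F s *v v) \<le> 0)"

lemma bounded_coeff_const: "bounded_coeff T (\<lambda>_. A)"
  unfolding bounded_coeff_def using norm_matrix_vector_le[of A] by auto

lemma measurable_matrix_vector [measurable (raw)]:
  fixes F :: "'a \<Rightarrow> real^'n^'m" and x :: "'a \<Rightarrow> real^'n"
  assumes "F \<in> borel_measurable M" "x \<in> borel_measurable M"
  shows "(\<lambda>s. F s *v x s) \<in> borel_measurable M"
  by (rule borel_measurable_continuous_Pair[OF assms])
     (intro bounded_bilinear.continuous_on[OF bounded_bilinear_matrix_vector_mult] continuous_intros)

lemma bounded_coeff_integrable:
  assumes F: "bounded_coeff T F" and x: "continuous_on {0..T} x"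
  shows "integrable (lebesgue_on {0..T}) (\<lambda>s. F s *v x s)"
proof -
  obtain c where c: "\<And>s. s \<in> {0..T} \<Longrightarrow> norm (x s) \<le> c"
    using continuous_bounded_interval[OF x] by blast
  obtain L where L: "\<And>s v. s \<in> {0..T} \<Longrightarrow> norm (F s *v v) \<le> L * norm v"
    and [measurable]: "F \<in> borel_measurable (lebesgue_on {0..T})"
    using F unfolding bounded_coeff_def by blast
  note [measurable] = measurable_continuous_interval[OF x]
  show ?thesis
  proof (rule integrable_bounded_measurable[of _ _ _ "\<bar>L\<bar> * c"])
    fix s assume s: "s \<in> {0..T}"
    have "norm (F s *v x s) \<le> \<bar>L\<bar> * norm (x s)"
      using L[OF s] by (meson abs_ge_self mult_right_mono norm_ge_zero order_trans)
    also have "\<dots> \<le> \<bar>L\<bar> * c" using c[OF s] by (simp add: mult_left_mono)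
    finally show "norm (F s *v x s) \<le> \<bar>L\<bar> * c" .
  qed measurable
qed

text \<open>
Substituting \<open>x t = exp (mu * t) *\<^sub>R z t\<close> with \<open>mu\<close> larger than twice the bound \<open>L\<close> of the
coefficient turns the integral equation into a fixed point equation whose right-hand side is a
contraction with constant \<open>1/2\<close> in the supremum norm on all of \<open>{0..T}\<close>, so no gluing of short time
intervals is required. Functions on \<open>{0..T}\<close> become bounded continuous functions on the line by
clamping the argument.
\<close>

lemma linear_ode_exists:
  fixes F :: "real \<Rightarrow> real^'n^'n"
  assumes T: "0 \<le> T" and F: "bounded_coeff T F" and f: "integrable (lebesgue_on {0..T}) f"
  obtains x where "x 0 = c" "primitive_on T (\<lambda>s. F s *v x s + f s) x"
proof -
  obtain L0 where L0: "\<And>s v. s \<in> {0..T} \<Longrightarrow> norm (F s *v v) \<le> L0 * norm v"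
    using F unfolding bounded_coeff_def by blast
  define L where "L = \<bar>L0\<bar>"
  have L: "norm (F s *v v) \<le> L * norm v" if "s \<in> {0..T}" for s v
    using L0[OF that] unfolding L_def by (meson abs_ge_self mult_right_mono norm_ge_zero order_trans)
  have L_nonneg: "0 \<le> L" by (simp add: L_def)
  define mu where "mu = 2 * L + 1"
  have lam: "mu > 0" using L_nonneg by (simp add: mu_def)
  define h where "h z s = exp (mu * s) *\<^sub>R (F s *v apply_bcontfun z s)" for z s
  have h: "integrable (lebesgue_on {0..t}) (h z)" if "t \<in> {0..T}" for t z
  proof -
    have "continuous_on {0..T} (\<lambda>s. exp (mu * s) *\<^sub>R apply_bcontfun z s)"
      by (intro continuous_intros continuous_on_apply_bcontfun)
    from bounded_coeff_integrable[OF F this]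
    have "integrable (lebesgue_on {0..T}) (h z)"
      by (simp add: h_def[abs_def] matrix_vector_mult_scaleR)
    then show ?thesis by (rule integrable_subinterval) (use that in auto)
  qed
  define \<Phi> where "\<Phi> z t = exp (- mu * t) *\<^sub>R
     (c + (LINT s|lebesgue_on {0..t}. f s) + (LINT s|lebesgue_on {0..t}. h z s))" for z t
  have "\<exists>w. \<forall>t. apply_bcontfun w t = \<Phi> z (clamp 0 T t)" for z
  proof -
    have "continuous_on (cbox 0 T) (\<Phi> z)"
      unfolding \<Phi>_def[abs_def] cbox_interval
      by (intro continuous_intros indefinite_integral_continuous_real h f) (use T in auto)
    from continuous_on_cbox_bcontfunE[OF this] show ?thesis by metis
  qed
  then obtain \<Psi> where \<Psi>: "\<And>z t. apply_bcontfun (\<Psi> z) t = \<Phi> z (clamp 0 T t)" by metis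
  \<comment> \<open>the weight \<open>exp (- mu * t)\<close> times this integral is at most \<open>1 / mu\<close>, which beats the bound \<open>L\<close>\<close>
  have exp_int: "(LINT s|lebesgue_on {0..t}. exp (mu * s)) = (exp (mu * t) - 1) / mu" if "0 \<le> t" for t
  proof -
    have "((\<lambda>s. exp (mu * s)) has_integral (exp (mu * t) / mu - exp (mu * 0) / mu)) {0..t}"
      by (rule fundamental_theorem_of_calculus[OF that])
         (use lam in \<open>auto intro!: derivative_eq_intros simp flip: has_real_derivative_iff_has_vector_derivative\<close>)
    moreover have "integrable (lebesgue_on {0..t}) (\<lambda>s. exp (mu * s))"
      by (intro continuous_imp_integrable_real continuous_intros)
    ultimately show ?thesis
      by (simp add: lebesgue_integral_eq_integral integral_unique diff_divide_distrib)
  qed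
  have "dist (\<Psi> z) (\<Psi> w) \<le> 1/2 * dist z w" for z w
  proof (rule dist_bound)
    fix r
    define t where "t = clamp 0 T r"
    have t: "t \<in> {0..T}" using clamp_in_interval[of 0 T r] T by (simp add: t_def)
    have "\<Phi> z t - \<Phi> w t = exp (- mu * t) *\<^sub>R (LINT s|lebesgue_on {0..t}. h z s - h w s)"
      using h[OF t] by (simp add: \<Phi>_def algebra_simps)
    also have "norm \<dots> \<le> exp (- mu * t) * (LINT s|lebesgue_on {0..t}. exp (mu * s) * (L * dist z w))"
    proof -
      have "norm (LINT s|lebesgue_on {0..t}. h z s - h w s) \<le> (LINT s|lebesgue_on {0..t}. exp (mu * s) * (L * dist z w))"
      proof (rule Bochner_Integration.integral_norm_bound_integral)
        show "integrable (lebesgue_on {0..t}) (\<lambda>s. exp (mu * s) * (L * dist z w))"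
          by (intro continuous_imp_integrable_real continuous_intros)
        show "norm (h z s - h w s) \<le> exp (mu * s) * (L * dist z w)" if "s \<in> space (lebesgue_on {0..t})" for s
        proof -
          have s: "s \<in> {0..T}" using that t by auto
          have "norm (h z s - h w s) = exp (mu * s) * norm (F s *v (z s - w s))"
            by (simp add: h_def matrix_vector_mult_diff_distrib flip: scaleR_diff_right)
          also have "norm (F s *v (z s - w s)) \<le> L * norm (z s - w s)" by (rule L[OF s])
          also have "\<dots> \<le> L * dist z w"
            using dist_bounded[of z s w] L_nonneg by (simp add: mult_left_mono flip: dist_norm)
          finally show ?thesis by simp
        qed
      qed (use h[OF t] in auto)
      then show ?thesis by simp
    qed
    also have "\<dots> = exp (- mu * t) * ((exp (mu * t) - 1) / mu) * (L * dist z w)"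
      using exp_int[of t] t by simp
    also have "exp (- mu * t) * ((exp (mu * t) - 1) / mu) = (1 - exp (- mu * t)) / mu"
      by (simp add: exp_minus field_simps)
    also have "\<dots> * (L * dist z w) \<le> 1 / mu * (L * dist z w)"
      using lam L_nonneg by (intro mult_right_mono) (auto simp: field_simps)
    also have "\<dots> = L / mu * dist z w" by simp
    also have "\<dots> \<le> 1/2 * dist z w"
      using L_nonneg lam by (intro mult_right_mono) (auto simp: mu_def field_simps)
    finally show "dist (apply_bcontfun (\<Psi> z) r) (apply_bcontfun (\<Psi> w) r) \<le> 1/2 * dist z w"
      by (simp add: \<Psi> dist_norm t_def)
  qed
  then obtain z where z: "\<Psi> z = z"
    using banach_fix_type[of "1/2" \<Psi>] by auto
  define x where "x t = exp (mu * t) *\<^sub>R apply_bcontfun z t" for t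
  have Fx: "h z s = F s *v x s" for s by (simp add: h_def x_def matrix_vector_mult_scaleR)
  have xeq: "x t = c + (LINT s|lebesgue_on {0..t}. F s *v x s + f s)" if t: "t \<in> {0..T}" for t
  proof -
    have "integrable (lebesgue_on {0..t}) f" by (rule integrable_subinterval[OF f]) (use t in auto)
    moreover have "clamp 0 T t = t" using t by (simp add: clamp_cancel_cbox)
    then have "apply_bcontfun z t = \<Phi> z t" using \<Psi>[of z t] z by simp
    ultimately show ?thesis
      using h[OF t, of z] unfolding Fx x_def[of t] \<Phi>_def 
      by (simp add: exp_minus Fx add.commute add.left_commute)
  qed
  show ?thesis
  proof
    show p: "primitive_on T (\<lambda>s. F s *v x s + f s) x"
    proof (rule primitive_onI[OF _ xeq])
      have "h z = (\<lambda>s. F s *v x s)" by (rule ext) (rule Fx)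
      then show "integrable (lebesgue_on {0..T}) (\<lambda>s. F s *v x s + f s)"
        using h[of T z] f T by simp
    qed
    have "{0} \<in> null_sets lebesgue" by (simp flip: negligible_iff_null_sets)
    then show "x 0 = c" using xeq[of 0] T by (simp add: integral_eq_zero_null_sets)
  qed
qed

text \<open>
Integrating the derivative of \<open>norm (x s)^2\<close> up to the time at which \<open>norm (x s)\<close> is largest, and
using the maximum \<open>X\<close> to bound the state under the integral, gives \<open>X^2 \<le> norm (x 0)^2 + 2 X \<integral> norm f\<close>.
The point of the estimate is that it does not involve the size of the coefficient: this is what makes
all later constants independent of the splitting.
\<close>

lemma dissipative_bound:
  assumes diss: "dissipative_on T F" and x: "primitive_on T (\<lambda>s. F s *v x s + f s) x"
    and f: "integrable (lebesgue_on {0..T}) f" and t: "t \<in> {0..T}"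
  shows "norm (x t) \<le> norm (x 0) + 2 * (LINT s|lebesgue_on {0..T}. norm (f s))"
proof -
  note cx = primitive_on_continuous[OF x]
  have "{0..T} \<noteq> {}" using t by auto
  then obtain r where r: "r \<in> {0..T}" and max: "\<And>s. s \<in> {0..T} \<Longrightarrow> norm (x s) \<le> norm (x r)"
    using continuous_attains_sup[OF compact_Icc _ continuous_on_norm[OF cx]] by blast
  let ?b = "LINT s|lebesgue_on {0..T}. norm (f s)"
  note xr = primitive_on_subset[OF x, of r]
  have fr: "integrable (lebesgue_on {0..r}) f" by (rule integrable_subinterval[OF f]) (use r in auto)
  have xx: "primitive_on r (\<lambda>s. (F s *v x s + f s) \<bullet> x s + x s \<bullet> (F s *v x s + f s)) (\<lambda>s. x s \<bullet> x s)"
    using r by (intro primitive_on_inner xr) auto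
  have "x r \<bullet> x r - x 0 \<bullet> x 0 = (LINT s|lebesgue_on {0..r}. (F s *v x s + f s) \<bullet> x s + x s \<bullet> (F s *v x s + f s))"
    using primitive_on_increment[OF xx, of 0 r] r by simp
  also have "\<dots> \<le> (LINT s|lebesgue_on {0..r}. 2 * norm (x r) * norm (f s))"
  proof (rule integral_mono)
    fix s assume "s \<in> space (lebesgue_on {0..r})"
    then have s: "s \<in> {0..T}" using r by auto
    have "x s \<bullet> f s \<le> norm (x s) * norm (f s)" by (rule norm_cauchy_schwarz)
    also have "\<dots> \<le> norm (x r) * norm (f s)" using max[OF s] by (simp add: mult_right_mono)
    finally show "(F s *v x s + f s) \<bullet> x s + x s \<bullet> (F s *v x s + f s) \<le> 2 * norm (x r) * norm (f s)"
      using diss[unfolded dissipative_on_def, rule_format, OF s, of "x s"]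
      by (simp add: inner_add_left inner_add_right inner_commute)
  qed (use fr primitive_on_integrable[OF xx] in auto)
  also have "\<dots> = 2 * norm (x r) * (LINT s|lebesgue_on {0..r}. norm (f s))" by simp
  also have "(LINT s|lebesgue_on {0..r}. norm (f s)) \<le> ?b"
    by (rule integral_mono_interval) (use f r in auto)
  finally have *: "norm (x r) * norm (x r) \<le> norm (x 0) * norm (x 0) + 2 * norm (x r) * ?b"
    by (simp add: mult_left_mono flip: power2_norm_eq_inner power2_eq_square)
  have b: "0 \<le> ?b" by simp
  have "norm (x r) \<le> norm (x 0) + 2 * ?b"
  proof (rule ccontr)
    assume n: "\<not> ?thesis"
    then have "0 < norm (x r)" "norm (x 0) \<le> norm (x r)" using b norm_ge_zero[of "x 0"] by linarith+
    moreover from this(2) have "norm (x 0) * norm (x 0) \<le> norm (x r) * norm (x 0)"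
      by (rule mult_right_mono) simp
    ultimately have "norm (x 0) * norm (x 0) + 2 * norm (x r) * ?b < norm (x r) * norm (x r)"
      using mult_strict_left_mono[of "norm (x 0) + 2 * ?b" "norm (x r)" "norm (x r)"] n
      by (simp add: algebra_simps)
    with * show False by simp
  qed
  with max[OF t] show ?thesis by simp
qed

lemma linear_ode_unique:
  assumes diss: "dissipative_on T F"
    and x: "primitive_on T (\<lambda>s. F s *v x s + f s) x" and y: "primitive_on T (\<lambda>s. F s *v y s + f s) y"
    and "x 0 = y 0" and t: "t \<in> {0..T}"
  shows "x t = y t"
proof -
  have "primitive_on T (\<lambda>s. F s *v (x s - y s) + 0) (\<lambda>s. x s - y s)"
    using primitive_on_diff[OF x y] by (simp add: matrix_vector_mult_diff_distrib)
  from dissipative_bound[OF diss this _ t] assms(4) show ?thesis by simp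
qed

text \<open>
The adjoint equation runs backwards from the end value \<open>0\<close>; \<open>p\<close> is its time reversal, so that it
solves an initial value problem of the same kind as the state. The product of \<open>z\<close> with the adjoint
state vanishes at both ends, and its derivative is the difference of the two integrands.
\<close>

lemma adjoint_duality:
  fixes F :: "real \<Rightarrow> real^'n^'n"
  assumes T: "0 \<le> T"
    and p: "primitive_on T (\<lambda>s. transpose (F (T - s)) *v p s + q (T - s)) p" "p 0 = 0"
    and z: "primitive_on T (\<lambda>s. F s *v z s + f s) z" "z 0 = 0"
    and q: "integrable (lebesgue_on {0..T}) q" and f: "integrable (lebesgue_on {0..T}) f"
  shows "(LINT s|lebesgue_on {0..T}. q s \<bullet> z s) = (LINT s|lebesgue_on {0..T}. p (T - s) \<bullet> f s)"
proof -
  have r: "primitive_on T (\<lambda>s. - (transpose (F s) *v p (T - s) + q s)) (\<lambda>s. p (T - s))"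
    using primitive_on_reflect[OF p(1)] by simp
  have "primitive_on T (\<lambda>s. - (transpose (F s) *v p (T - s) + q s) \<bullet> z s + p (T - s) \<bullet> (F s *v z s + f s))
      (\<lambda>s. p (T - s) \<bullet> z s)" by (rule primitive_on_inner[OF r z(1)])
  then have i: "primitive_on T (\<lambda>s. p (T - s) \<bullet> f s - q s \<bullet> z s) (\<lambda>s. p (T - s) \<bullet> z s)"
    by (rule primitive_on_cong)
       (simp_all add: inner_add_left inner_add_right inner_diff_left inner_transpose
         del: transpose_matrix_vector)
  have "0 = (LINT s|lebesgue_on {0..T}. p (T - s) \<bullet> f s - q s \<bullet> z s)"
    using primitive_on_increment[OF i, of 0 T] T p(2) z(2) by simp
  also have "\<dots> = (LINT s|lebesgue_on {0..T}. p (T - s) \<bullet> f s) - (LINT s|lebesgue_on {0..T}. q s \<bullet> z s)"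
    using integrable_inner_continuous[OF q primitive_on_continuous[OF z(1)]]
      integrable_inner_continuous[OF f primitive_on_continuous[OF r]]
    by (intro Bochner_Integration.integral_diff) (simp_all add: inner_commute)
  finally show ?thesis by simp
qed

text \<open>
Derivatives may be changed at the two end points. This matters because neighbouring grid cells
share a grid point and only one of them owns it.
\<close>

lemma primitive_on_cong_interior:
  fixes x :: "real \<Rightarrow> 'a::euclidean_space"
  assumes "primitive_on T g x" "\<And>s. 0 < s \<Longrightarrow> s < T \<Longrightarrow> g' s = g s"
  shows "primitive_on T g' x"
proof -
  have cong: "integrable (lebesgue_on {0..t}) g' \<and> 
      (LINT s|lebesgue_on {0..t}. g' s) = (LINT s|lebesgue_on {0..t}. g s)" if t: "t \<in> {0..T}" for t
  proof -
    have i: "integrable (lebesgue_on {0..t}) g"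
      by (rule integrable_subinterval[OF primitive_on_integrable[OF assms(1)]]) (use t in auto)
    then have "g absolutely_integrable_on {0..t}"
      by (simp add: set_integrable_def integrable_restrict_space)
    then have "g' absolutely_integrable_on {0..t}"
      by (rule absolutely_integrable_spike[where S = "{0, t}"]) (use assms(2) t in auto)
    then have i': "integrable (lebesgue_on {0..t}) g'" by (rule absolutely_integrable_imp_integrable) simp
    have "AE s in lebesgue_on {0..t}. g' s = g s"
      by (rule AE_mp[OF AE_interior]) (use assms(2) t in auto)
    then have "(LINT s|lebesgue_on {0..t}. g' s) = (LINT s|lebesgue_on {0..t}. g s)"
      by (intro integral_cong_AE) (use i i' in auto)
    with i' show ?thesis by simp
  qed
  show ?thesis
  proof (cases "0 \<le> T")
    case True
    show ?thesis
    proof (rule primitive_onI[of _ _ _ "x 0"])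
      show "integrable (lebesgue_on {0..T}) g'" using cong[of T] True by simp
      show "x t = x 0 + (LINT s|lebesgue_on {0..t}. g' s)" if "t \<in> {0..T}" for t
        using cong[OF that] primitive_on_eq[OF assms(1) that] by metis
    qed
  next
    case False
    then show ?thesis using assms(1) by (simp add: primitive_on_def integrable_cong)
  qed
qed

text \<open>
Causality: the solution at time \<open>a\<close> depends on the coefficient only before \<open>a\<close>. Applied to
the random systems, it says that the state at a grid point is independent of the later indices.
\<close>

lemma linear_ode_local:
  assumes diss: "dissipative_on T F" and a: "a \<in> {0..T}"
    and x: "primitive_on T (\<lambda>s. F s *v x s + f s) x" and y: "primitive_on T (\<lambda>s. F' s *v y s + f' s) y"
    and "x 0 = y 0" and FF: "\<And>s. 0 < s \<Longrightarrow> s < a \<Longrightarrow> F' s = F s \<and> f' s = f s"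
  shows "x a = y a"
proof (rule linear_ode_unique)
  show "dissipative_on a F" using diss a by (auto simp: dissipative_on_def)
  show "primitive_on a (\<lambda>s. F s *v x s + f s) x" by (rule primitive_on_subset[OF x]) (use a in auto)
  show "primitive_on a (\<lambda>s. F s *v y s + f s) y" 
    by (rule primitive_on_cong_interior, rule primitive_on_subset[OF y]) (use a FF in auto)
qed (use assms in auto)

section \<open>Expectations over independent subset choices\<close>

locale subset_weights =
  fixes M K :: nat and p :: "nat \<Rightarrow> real"
  assumes p_nonneg: "j \<in> {1..2^M} \<Longrightarrow> 0 \<le> p j" and p_sum: "(\<Sum>j=1..2^M. p j) = 1"
begin

abbreviation "\<Omega> \<equiv> sample_space M K"
abbreviation "E \<equiv> expect M p K"

lemma weight_nonneg: "w \<in> \<Omega> \<Longrightarrow> 0 \<le> (\<Prod>k=1..K. p (w k))"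
  unfolding sample_space_def by (intro prod_nonneg ballI p_nonneg) (rule PiE_mem)

lemma sample_space_mem: "w \<in> \<Omega> \<Longrightarrow> k \<in> {1..K} \<Longrightarrow> w k \<in> {1..2^M}"
  unfolding sample_space_def by (rule PiE_mem)

lemma E_mono: "(\<And>w. w \<in> \<Omega> \<Longrightarrow> X w \<le> Y w) \<Longrightarrow> E X \<le> E Y"
  unfolding expect_def by (intro sum_mono mult_right_mono weight_nonneg)

lemma E_cong: "(\<And>w. w \<in> \<Omega> \<Longrightarrow> X w = Y w) \<Longrightarrow> E X = E Y"
  unfolding expect_def by (intro sum.cong) auto

lemma E_add: "E (\<lambda>w. X w + Y w) = E X + E Y"
  by (simp add: expect_def sum.distrib algebra_simps)

lemma E_cmult: "E (\<lambda>w. c * X w) = c * E X"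
  by (simp add: expect_def sum_distrib_left algebra_simps)

lemma E_const: "E (\<lambda>_. c) = c"
proof -
  have "(\<Sum>w\<in>\<Omega>. \<Prod>k=1..K. p (w k)) = (\<Prod>k=1..K. \<Sum>j=1..2^M. p j)"
    unfolding sample_space_def by (subst prod_sum_PiE) auto
  then show ?thesis unfolding expect_def p_sum sum_distrib_left[symmetric] by simp
qed

lemma
  assumes "\<And>w. w \<in> \<Omega> \<Longrightarrow> integrable N (f w)"
  shows E_integral: "E (\<lambda>w. LINT s|N. f w s) = (LINT s|N. E (\<lambda>w. f w s))"
    and E_integrable: "integrable N (\<lambda>s. E (\<lambda>w. f w s))"
  using assms by (auto simp: expect_def)

text \<open>
Conditional averaging: drawing the coordinate \<open>k\<close> a second time, independently of everything
else, does not change an expectation. This is the only form in which independence is used.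
\<close>

lemma E_resample:
  assumes k: "k \<in> {1..K}"
  shows "E X = E (\<lambda>w. \<Sum>j=1..2^M. p j * X (w(k := j)))"
proof -
  let ?I = "{1..K} - {k}" and ?J = "{1..2^M::nat}"
  let ?P = "?I \<rightarrow>\<^sub>E ?J"
  let ?W = "\<lambda>\<eta>. \<Prod>i\<in>?I. p (\<eta> i)"
  have IK: "{1..K} = insert k ?I" using k by auto
  have expand: "E Y = (\<Sum>j\<in>?J. \<Sum>\<eta>\<in>?P. Y (\<eta>(k := j)) * (p j * ?W \<eta>))" for Y
  proof -
    have "E Y = (\<Sum>w\<in>(\<lambda>(y, g). g(k := y)) ` (?J \<times> ?P). Y w * (\<Prod>i=1..K. p (w i)))"
      unfolding expect_def sample_space_def by (subst IK, subst PiE_insert_eq) simp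
    also have "\<dots> = (\<Sum>(j, \<eta>)\<in>?J \<times> ?P. Y (\<eta>(k := j)) * (\<Prod>i=1..K. p ((\<eta>(k := j)) i)))"
      using inj_combinator[of k ?I "\<lambda>_. ?J"] by (subst sum.reindex) (auto simp: case_prod_beta)
    also have "\<dots> = (\<Sum>j\<in>?J. \<Sum>\<eta>\<in>?P. Y (\<eta>(k := j)) * (\<Prod>i=1..K. p ((\<eta>(k := j)) i)))"
      by (rule sum.cartesian_product[symmetric])
    also have "(\<lambda>j \<eta>. \<Prod>i=1..K. p ((\<eta>(k := j)) i)) = (\<lambda>j \<eta>. p j * ?W \<eta>)"
      by (intro ext, subst IK, subst prod.insert) (auto intro!: prod.cong)
    from fun_cong[OF fun_cong[OF this]] 
    have "(\<Sum>j\<in>?J. \<Sum>\<eta>\<in>?P. Y (\<eta>(k := j)) * (\<Prod>i=1..K. p ((\<eta>(k := j)) i)))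
      = (\<Sum>j\<in>?J. \<Sum>\<eta>\<in>?P. Y (\<eta>(k := j)) * (p j * ?W \<eta>))" by (intro sum.cong refl) metis
    finally show ?thesis .
  qed
  have "E (\<lambda>w. \<Sum>j\<in>?J. p j * X (w(k := j)))
      = (\<Sum>i\<in>?J. \<Sum>\<eta>\<in>?P. (\<Sum>j\<in>?J. p j * X (\<eta>(k := j))) * (p i * ?W \<eta>))"
    by (subst expand) simp
  also have "\<dots> = (\<Sum>i\<in>?J. p i * (\<Sum>\<eta>\<in>?P. (\<Sum>j\<in>?J. p j * X (\<eta>(k := j))) * ?W \<eta>))"
    by (simp add: sum_distrib_left mult.left_commute)
  also have "\<dots> = (\<Sum>\<eta>\<in>?P. (\<Sum>j\<in>?J. p j * X (\<eta>(k := j))) * ?W \<eta>)"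
    by (simp only: p_sum sum_distrib_right[symmetric] mult_1_left)
  also have "\<dots> = (\<Sum>\<eta>\<in>?P. \<Sum>j\<in>?J. X (\<eta>(k := j)) * (p j * ?W \<eta>))"
    by (simp add: sum_distrib_right sum_distrib_left mult_ac)
  also have "\<dots> = E X" by (subst expand) (rule sum.swap)
  finally show ?thesis by simp
qed

lemma E_coordinate: "k \<in> {1..K} \<Longrightarrow> E (\<lambda>w. g (w k)) = (\<Sum>j=1..2^M. g j * p j)"
  by (subst E_resample[of k]) (simp_all add: E_const mult.commute)

end

section \<open>Perturbation by a mean zero random coefficient\<close>

text \<open>
The heart of the matter. The error \<open>y\<close> is driven by the mean zero matrix \<open>G - D\<close> acting on a
deterministic function \<open>x\<close>. Dissipativity of \<open>G\<close> leaves, in expectation,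
\<open>(norm (y t))^2 \<le> 2 \<integral> y \<bullet> (G - D) x\<close>. On a grid cell the value of \<open>y\<close> at the beginning of the cell is
independent of the index drawn in the cell, hence contributes nothing; only the increment of \<open>y\<close> since
then is left, which is of order \<open>h\<close>.

To obtain the factor \<open>V\<close> without any bound on \<open>G\<close>, the increment is written with the right-hand side
\<open>D y + (G - D) (x + y)\<close>. The second summand is multiplied by another \<open>G - D\<close> and yields \<open>V\<close>; for the
first one, the cruder estimate \<open>E (norm (y r))^2 \<le> 4 T^2 c^2 V\<close>, which has no power of \<open>h\<close>, suffices.

The assumption \<open>step\<close> describes the cell in terms of its starting point \<open>a\<close> instead of a grid. In this
form it holds both for the state and for the time reversed adjoint state, whose cells are traversed in
the opposite order.
\<close>

lemma random_perturbation_estimate: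
  fixes G :: "(nat \<Rightarrow> nat) \<Rightarrow> real \<Rightarrow> real^'n^'n" and g :: "nat \<Rightarrow> real^'n^'n" and D :: "real^'n^'n"
    and x :: "real \<Rightarrow> real^'n" and y :: "(nat \<Rightarrow> nat) \<Rightarrow> real \<Rightarrow> real^'n"
  assumes weights: "subset_weights M p" and T: "0 < T" and h: "0 \<le> h"
    and diss: "\<And>w. w \<in> sample_space M K \<Longrightarrow> dissipative_on T (G w)"
    and coeff: "\<And>w. w \<in> sample_space M K \<Longrightarrow> bounded_coeff T (G w)"
    and y: "\<And>w. w \<in> sample_space M K \<Longrightarrow> primitive_on T (\<lambda>s. G w s *v y w s + (G w s - D) *v x s) (y w)"
    and y0: "\<And>w. w \<in> sample_space M K \<Longrightarrow> y w 0 = 0"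
    and x: "continuous_on {0..T} x"
    and xc: "\<And>s. s \<in> {0..T} \<Longrightarrow> norm (x s) \<le> c"
    and xyc: "\<And>w s. w \<in> sample_space M K \<Longrightarrow> s \<in> {0..T} \<Longrightarrow> norm (x s + y w s) \<le> c"
    and step: "\<And>s. 0 < s \<Longrightarrow> s < T \<Longrightarrow> \<exists>k\<in>{1..K}. \<exists>a\<in>{0..s}. s - a \<le> h \<and>
        (\<forall>w\<in>sample_space M K. G w s = g (w k) \<and> (\<forall>r. a < r \<longrightarrow> r < s \<longrightarrow> G w r = g (w k)) \<and>
           (\<forall>j\<in>{1..2^M}. y (w(k := j)) a = y w a))"
    and mean: "(\<Sum>j=1..2^M. p j *\<^sub>R g j) = D"
    and \<delta>: "\<And>j v. j \<in> {1..2^M} \<Longrightarrow> norm ((g j - D) *v v) \<le> \<delta> j * norm v" "\<And>j. 0 \<le> \<delta> j"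
    and d: "\<And>v. norm (D *v v) \<le> d * norm v" "0 \<le> d"
    and V: "V = (\<Sum>j=1..2^M. (\<delta> j)\<^sup>2 * p j)"
    and t: "t \<in> {0..T}"
  shows "expect M p K (\<lambda>w. (norm (y w t))\<^sup>2) \<le> 2 * T * (c\<^sup>2 + c * d * (1 + 4 * T\<^sup>2 * c\<^sup>2) / 2) * h * V"
proof -
  interpret subset_weights M K p by (rule weights)
  have c: "0 \<le> c" using xc[OF t] norm_ge_zero order_trans by blast
  have V0: "0 \<le> V" unfolding V by (intro sum_nonneg mult_nonneg_nonneg p_nonneg) auto
  have EV: "E (\<lambda>w. (\<delta> (w k))\<^sup>2) = V" if "k \<in> {1..K}" for k
    unfolding V by (rule E_coordinate[OF that])
  let ?f = "\<lambda>w s. (G w s - D) *v x s"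
  have fi: "integrable (lebesgue_on {0..T}) (?f w)" if "w \<in> \<Omega>" for w
    using bounded_coeff_integrable[OF coeff[OF that] x] bounded_coeff_integrable[OF bounded_coeff_const[of T D] x]
    by (simp add: matrix_vector_mult_diff_rdistrib)
  have fb: "\<exists>b. \<forall>s\<in>{0..T}. norm (?f w s) \<le> b" if w: "w \<in> \<Omega>" for w
  proof -
    obtain L where L: "\<And>s v. s \<in> {0..T} \<Longrightarrow> norm (G w s *v v) \<le> L * norm v"
      using coeff[OF w] unfolding bounded_coeff_def by blast
    have "norm (?f w s) \<le> \<bar>L\<bar> * c + d * c" if s: "s \<in> {0..T}" for s
    proof -
      have "norm (G w s *v x s) \<le> L * norm (x s)" by (rule L[OF s])
      also have "\<dots> \<le> \<bar>L\<bar> * norm (x s)" by (rule mult_right_mono) auto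
      also have "\<dots> \<le> \<bar>L\<bar> * c" by (rule mult_left_mono[OF xc[OF s]]) simp
      finally have 1: "norm (G w s *v x s) \<le> \<bar>L\<bar> * c" .
      have "norm (D *v x s) \<le> d * c"
        by (rule order_trans[OF d(1) mult_left_mono[OF xc[OF s] d(2)]])
      with 1 show ?thesis
        unfolding matrix_vector_mult_diff_rdistrib by (rule norm_triangle_le_diff[OF add_mono])
    qed
    then show ?thesis by blast
  qed
  have f2i: "integrable (lebesgue_on {0..T}) (\<lambda>s. (norm (?f w s))\<^sup>2)" if w: "w \<in> \<Omega>" for w
  proof -
    obtain b where b: "\<And>s. s \<in> {0..T} \<Longrightarrow> norm (?f w s) \<le> b" using fb[OF w] by blast
    note [measurable] = borel_measurable_integrable[OF fi[OF w]]
    show ?thesis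
      by (rule integrable_bounded_measurable[of _ _ _ "b\<^sup>2"]) (use b in \<open>auto intro!: power_mono\<close>)
  qed
  have Nle: "norm ((g (w k) - D) *v x s) \<le> \<delta> (w k) * c" if "w \<in> \<Omega>" "k \<in> {1..K}" "s \<in> {0..T}" for w k s
    by (rule order_trans[OF \<delta>(1)[OF sample_space_mem[OF that(1,2)]] mult_left_mono[OF xc[OF that(3)] \<delta>(2)]])
  have crude: "E (\<lambda>w. (norm (y w r))\<^sup>2) \<le> 4 * T\<^sup>2 * c\<^sup>2 * V" if r: "r \<in> {0..T}" for r
  proof -
    have "(norm (y w r))\<^sup>2 \<le> 4 * T * (LINT s|lebesgue_on {0..T}. (norm (?f w s))\<^sup>2)" if w: "w \<in> \<Omega>" for w
    proof -
      have "norm (y w r) \<le> 2 * (LINT s|lebesgue_on {0..T}. norm (?f w s))"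
        using dissipative_bound[OF diss[OF w] y[OF w] fi[OF w] r] y0[OF w] by simp
      then have "(norm (y w r))\<^sup>2 \<le> (2 * (LINT s|lebesgue_on {0..T}. norm (?f w s)))\<^sup>2"
        by (rule power_mono) simp
      also have "\<dots> = 4 * (LINT s|lebesgue_on {0..T}. norm (?f w s) * 1)\<^sup>2" by (simp add: power_mult_distrib)
      also have "(LINT s|lebesgue_on {0..T}. norm (?f w s) * 1)\<^sup>2 \<le>
          (LINT s|lebesgue_on {0..T}. (norm (?f w s))\<^sup>2) * (LINT s|lebesgue_on {0..T}. 1\<^sup>2)"
        using f2i[OF w] fi[OF w]
        by (intro integral_Cauchy_Schwarz) (auto intro: continuous_imp_integrable_real continuous_intros)
      also have "(LINT s|lebesgue_on {0..T}. 1\<^sup>2) = T" using T by (simp add: measure_restrict_space)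
      finally show ?thesis by (simp add: ac_simps)
    qed
    then have "E (\<lambda>w. (norm (y w r))\<^sup>2) \<le> E (\<lambda>w. 4 * T * (LINT s|lebesgue_on {0..T}. (norm (?f w s))\<^sup>2))"
      by (rule E_mono)
    also have "\<dots> = 4 * T * (LINT s|lebesgue_on {0..T}. E (\<lambda>w. (norm (?f w s))\<^sup>2))"
      by (simp only: E_cmult E_integral[OF f2i])
    also have "(LINT s|lebesgue_on {0..T}. E (\<lambda>w. (norm (?f w s))\<^sup>2)) \<le> (T - 0) * (c\<^sup>2 * V)"
    proof (rule integral_le_interior)
      fix s assume s: "0 < s" "s < T"
      obtain k where k: "k \<in> {1..K}" and Gk: "\<And>w. w \<in> \<Omega> \<Longrightarrow> G w s = g (w k)"
        using step[OF s] by blast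
      have "E (\<lambda>w. (norm (?f w s))\<^sup>2) \<le> E (\<lambda>w. c\<^sup>2 * (\<delta> (w k))\<^sup>2)"
      proof (rule E_mono)
        fix w assume w: "w \<in> \<Omega>"
        have "norm (?f w s) \<le> \<delta> (w k) * c" using Nle[OF w k, of s] s by (simp add: Gk[OF w])
        then have "(norm (?f w s))\<^sup>2 \<le> (\<delta> (w k) * c)\<^sup>2" by (rule power_mono) simp
        then show "(norm (?f w s))\<^sup>2 \<le> c\<^sup>2 * (\<delta> (w k))\<^sup>2" by (simp add: power_mult_distrib ac_simps)
      qed
      then show "E (\<lambda>w. (norm (?f w s))\<^sup>2) \<le> c\<^sup>2 * V" by (simp only: E_cmult EV[OF k])
    qed (use E_integrable[OF f2i] T in auto)
    finally show ?thesis using T by (simp add: power2_eq_square mult_left_mono ac_simps)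
  qed
  \<comment> \<open>Both terms of \<open>\<kappa>\<close> come from the increment of \<open>y\<close> within a cell: \<open>c\<^sup>2\<close> from its random part, the
    other one from its part \<open>D y\<close>, estimated by \<open>crude\<close>.\<close>
  define \<kappa> where "\<kappa> = c\<^sup>2 + c * d * (1 + 4 * T\<^sup>2 * c\<^sup>2) / 2"
  have mean0: "(\<Sum>j=1..2^M. p j *\<^sub>R ((g j - D) *v v)) = 0" for v
  proof -
    have "(\<Sum>j=1..2^M. p j *\<^sub>R ((g j - D) *v v)) = (\<Sum>j=1..2^M. (p j *\<^sub>R g j) *v v - p j *\<^sub>R (D *v v))"
      by (simp add: matrix_vector_mult_diff_rdistrib scaleR_diff_right scaleR_matrix_vector_assoc)
    also have "\<dots> = (\<Sum>j=1..2^M. p j *\<^sub>R g j) *v v - (\<Sum>j=1..2^M. p j) *\<^sub>R (D *v v)"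
      by (simp only: sum_subtractf scaleR_sum_left
          bounded_bilinear.sum_left[OF bounded_bilinear_matrix_vector_mult])
    finally show ?thesis by (simp only: mean p_sum) simp
  qed
  have drift: "E (\<lambda>w. y w s \<bullet> ?f w s) \<le> \<kappa> * h * V" if s: "0 < s" "s < T" for s
  proof -
    obtain k a where k: "k \<in> {1..K}" and a: "0 \<le> a" "a \<le> s" "s - a \<le> h"
      and Gs: "\<And>w. w \<in> \<Omega> \<Longrightarrow> G w s = g (w k)"
      and Gr: "\<And>w r. w \<in> \<Omega> \<Longrightarrow> a < r \<Longrightarrow> r < s \<Longrightarrow> G w r = g (w k)"
      and indep: "\<And>w j. w \<in> \<Omega> \<Longrightarrow> j \<in> {1..2^M} \<Longrightarrow> y (w(k := j)) a = y w a"
      using step[OF s] by (auto simp only: Bex_def Ball_def atLeastAtMost_iff)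
    \<comment> \<open>redrawing the index of the current cell leaves \<open>y w a\<close> unchanged and averages \<open>G - D\<close> to zero\<close>
    have "E (\<lambda>w. y w a \<bullet> ?f w s) = E (\<lambda>w. y w a \<bullet> ((g (w k) - D) *v x s))"
      by (rule E_cong) (simp add: Gs)
    also have "\<dots> = E (\<lambda>w. \<Sum>j=1..2^M. p j * (y (w(k := j)) a \<bullet> ((g ((w(k := j)) k) - D) *v x s)))"
      by (rule E_resample[OF k])
    also have "\<dots> = E (\<lambda>w. y w a \<bullet> (\<Sum>j=1..2^M. p j *\<^sub>R ((g j - D) *v x s)))"
      unfolding inner_sum_right by (intro E_cong sum.cong) (simp_all add: indep)
    also have "\<dots> = 0" by (simp only: mean0 E_const inner_zero_right)
    finally have start: "E (\<lambda>w. y w a \<bullet> ?f w s) = 0" .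
    have ysq: "integrable (lebesgue_on {a..s}) (\<lambda>r. ((\<delta> (w k))\<^sup>2 + (norm (y w r))\<^sup>2) / 2)" if w: "w \<in> \<Omega>" for w
    proof (intro continuous_imp_integrable_real continuous_intros)
      show "continuous_on {a..s} (y w)"
        by (rule continuous_on_subset[OF primitive_on_continuous[OF y[OF w]]]) (use a s in auto)
    qed auto
    have expand: "y w s \<bullet> ?f w s \<le> y w a \<bullet> ?f w s + (c\<^sup>2 * h * (\<delta> (w k))\<^sup>2
        + c * d * (LINT r|lebesgue_on {a..s}. ((\<delta> (w k))\<^sup>2 + (norm (y w r))\<^sup>2) / 2))" if w: "w \<in> \<Omega>" for w
    proof -
      let ?\<delta> = "\<delta> (w k)"
      have sT: "s \<in> {0..T}" using s by auto
      have cy: "continuous_on {a..s} (y w)"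
        by (rule continuous_on_subset[OF primitive_on_continuous[OF y[OF w]]]) (use a s in auto)
      have cyi: "integrable (lebesgue_on {a..s}) (\<lambda>r. ?\<delta> * c * (d * norm (y w r) + ?\<delta> * c))"
        by (intro continuous_imp_integrable_real continuous_intros cy)
      have yi: "integrable (lebesgue_on {a..s}) (\<lambda>r. G w r *v y w r + (G w r - D) *v x r)"
        by (rule integrable_subinterval[OF primitive_on_integrable[OF y[OF w]]]) (use a s in auto)
      have fs: "norm (?f w s) \<le> ?\<delta> * c" using Nle[OF w k sT] by (simp add: Gs[OF w])
      have "norm (y w s - y w a) = norm (LINT r|lebesgue_on {a..s}. G w r *v y w r + (G w r - D) *v x r)"
        using primitive_on_increment[OF y[OF w] a(1,2)] s by simp
      also have "\<dots> \<le> (LINT r|lebesgue_on {a..s}. norm (G w r *v y w r + (G w r - D) *v x r))"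
        by (rule integral_norm_bound)
      also have "\<dots> \<le> (LINT r|lebesgue_on {a..s}. d * norm (y w r) + ?\<delta> * c)"
      proof (rule integral_mono_interior)
        show "integrable (lebesgue_on {a..s}) (\<lambda>r. d * norm (y w r) + ?\<delta> * c)"
          by (intro continuous_imp_integrable_real continuous_intros cy)
        fix r assume r: "a < r" "r < s"
        have rT: "r \<in> {0..T}" using r a s by auto
        have "G w r *v y w r + (G w r - D) *v x r = D *v y w r + (g (w k) - D) *v (x r + y w r)"
          by (simp add: Gr[OF w r] matrix_vector_mult_diff_rdistrib matrix_vector_right_distrib)
        also have "norm \<dots> \<le> d * norm (y w r) + ?\<delta> * norm (x r + y w r)"
          by (rule norm_triangle_le[OF add_mono[OF d(1) \<delta>(1)[OF sample_space_mem[OF w k]]]])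
        also have "\<dots> \<le> d * norm (y w r) + ?\<delta> * c"
          using mult_left_mono[OF xyc[OF w rT] \<delta>(2)] by simp
        finally show "norm (G w r *v y w r + (G w r - D) *v x r) \<le> d * norm (y w r) + ?\<delta> * c" .
      qed (use yi in simp)
      finally have increment: "norm (y w s - y w a) \<le> (LINT r|lebesgue_on {a..s}. d * norm (y w r) + ?\<delta> * c)" .
      have "(y w s - y w a) \<bullet> ?f w s \<le> norm (y w s - y w a) * (?\<delta> * c)"
        by (rule order_trans[OF norm_cauchy_schwarz mult_left_mono[OF fs]]) simp
      also have "\<dots> \<le> (LINT r|lebesgue_on {a..s}. d * norm (y w r) + ?\<delta> * c) * (?\<delta> * c)"
        using c \<delta>(2)[of "w k"] by (intro mult_right_mono[OF increment]) simp
      also have "\<dots> =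
         (LINT r|lebesgue_on {a..s}. (d * norm (y w r) + ?\<delta> * c) * (?\<delta> * c))" by simp
      also have "\<dots> \<le> (LINT r|lebesgue_on {a..s}. c * d * ((?\<delta>\<^sup>2 + (norm (y w r))\<^sup>2) / 2) + c\<^sup>2 * ?\<delta>\<^sup>2)"
      proof (rule integral_mono_interior)
        fix r
        have "?\<delta> * norm (y w r) \<le> (?\<delta>\<^sup>2 + (norm (y w r))\<^sup>2) / 2"
          using sum_squares_bound[of ?\<delta> "norm (y w r)"] by simp
        from mult_left_mono[OF this, of "c * d"] 
        show "(d * norm (y w r) + ?\<delta> * c) * (?\<delta> * c) \<le> c * d * ((?\<delta>\<^sup>2 + (norm (y w r))\<^sup>2) / 2) + c\<^sup>2 * ?\<delta>\<^sup>2"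
          using c d(2) by (simp add: algebra_simps power2_eq_square)
      qed (intro continuous_imp_integrable_real continuous_intros cy, auto)+
      also have "\<dots> = (LINT r|lebesgue_on {a..s}. c * d * ((?\<delta>\<^sup>2 + (norm (y w r))\<^sup>2) / 2))
          + (LINT r|lebesgue_on {a..s}. c\<^sup>2 * ?\<delta>\<^sup>2)"
        by (rule Bochner_Integration.integral_add[OF integrable_mult_right[OF ysq[OF w]]
              continuous_imp_integrable_real[OF continuous_on_const]])
      also have "(LINT r|lebesgue_on {a..s}. c\<^sup>2 * ?\<delta>\<^sup>2) = (s - a) * (c\<^sup>2 * ?\<delta>\<^sup>2)"
        using a by (simp add: measure_restrict_space)
      also have "(LINT r|lebesgue_on {a..s}. c * d * ((?\<delta>\<^sup>2 + (norm (y w r))\<^sup>2) / 2))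
          = c * d * (LINT r|lebesgue_on {a..s}. (?\<delta>\<^sup>2 + (norm (y w r))\<^sup>2) / 2)"
        by (rule integral_mult_right_zero)
      also have "(s - a) * (c\<^sup>2 * ?\<delta>\<^sup>2) \<le> h * (c\<^sup>2 * ?\<delta>\<^sup>2)" using a(3) by (rule mult_right_mono) simp
      finally show ?thesis by (simp add: inner_diff_left ac_simps)
    qed
    have "(LINT r|lebesgue_on {a..s}. E (\<lambda>w. ((\<delta> (w k))\<^sup>2 + (norm (y w r))\<^sup>2) / 2))
        \<le> (s - a) * ((1 + 4 * T\<^sup>2 * c\<^sup>2) / 2 * V)"
    proof (rule integral_le_interior)
      fix r assume r: "a < r" "r < s"
      have "E (\<lambda>w. ((\<delta> (w k))\<^sup>2 + (norm (y w r))\<^sup>2) / 2) = 1/2 * (V + E (\<lambda>w. (norm (y w r))\<^sup>2))"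
        by (simp only: E_cmult[symmetric] E_add[symmetric] EV[OF k, symmetric]) (simp add: field_simps)
      also have "\<dots> \<le> 1/2 * (V + 4 * T\<^sup>2 * c\<^sup>2 * V)"
        using crude[of r] r a s by (simp add: algebra_simps)
      finally show "E (\<lambda>w. ((\<delta> (w k))\<^sup>2 + (norm (y w r))\<^sup>2) / 2) \<le> (1 + 4 * T\<^sup>2 * c\<^sup>2) / 2 * V"
        by (simp add: algebra_simps)
    qed (use E_integrable[OF ysq] a in auto)
    also have "(s - a) * ((1 + 4 * T\<^sup>2 * c\<^sup>2) / 2 * V) \<le> h * ((1 + 4 * T\<^sup>2 * c\<^sup>2) / 2 * V)"
      using a(3) V0 by (intro mult_right_mono mult_nonneg_nonneg) auto
    finally have average: "(LINT r|lebesgue_on {a..s}. E (\<lambda>w. ((\<delta> (w k))\<^sup>2 + (norm (y w r))\<^sup>2) / 2))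
        \<le> h * ((1 + 4 * T\<^sup>2 * c\<^sup>2) / 2 * V)" .
    from expand have "E (\<lambda>w. y w s \<bullet> ?f w s) \<le> E (\<lambda>w. y w a \<bullet> ?f w s + (c\<^sup>2 * h * (\<delta> (w k))\<^sup>2
        + c * d * (LINT r|lebesgue_on {a..s}. ((\<delta> (w k))\<^sup>2 + (norm (y w r))\<^sup>2) / 2)))" by (rule E_mono)
    also have "\<dots> = c\<^sup>2 * h * V
        + c * d * (LINT r|lebesgue_on {a..s}. E (\<lambda>w. ((\<delta> (w k))\<^sup>2 + (norm (y w r))\<^sup>2) / 2))"
      by (simp only: E_add E_cmult start EV[OF k] E_integral[of _ "\<lambda>w r. ((\<delta> (w k))\<^sup>2 + (norm (y w r))\<^sup>2) / 2", OF ysq] add_0_left)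
    also have "\<dots> \<le> c\<^sup>2 * h * V + c * d * (h * ((1 + 4 * T\<^sup>2 * c\<^sup>2) / 2 * V))"
      using c d(2) by (intro add_left_mono mult_left_mono[OF average]) simp
    finally show ?thesis by (simp add: \<kappa>_def algebra_simps)
  qed
  have fyi: "integrable (lebesgue_on {0..t}) (\<lambda>s. 2 * (y w s \<bullet> ?f w s))" if w: "w \<in> \<Omega>" for w
    using integrable_subinterval[OF integrable_inner_continuous[OF fi[OF w] primitive_on_continuous[OF y[OF w]]], of 0 t] t
    by (simp add: inner_commute)
  have "(norm (y w t))\<^sup>2 \<le> (LINT s|lebesgue_on {0..t}. 2 * (y w s \<bullet> ?f w s))" if w: "w \<in> \<Omega>" for w
  proof -
    let ?g = "\<lambda>s. G w s *v y w s + ?f w s"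
    have yy: "primitive_on t (\<lambda>s. ?g s \<bullet> y w s + y w s \<bullet> ?g s) (\<lambda>s. y w s \<bullet> y w s)"
      using t by (intro primitive_on_subset[OF primitive_on_inner[OF y[OF w] y[OF w]]]) auto
    have "(norm (y w t))\<^sup>2 = (LINT s|lebesgue_on {0..t}. ?g s \<bullet> y w s + y w s \<bullet> ?g s)"
      using primitive_on_increment[OF yy, of 0 t] t y0[OF w] by (simp add: power2_norm_eq_inner)
    also have "\<dots> \<le> (LINT s|lebesgue_on {0..t}. 2 * (y w s \<bullet> ?f w s))"
    proof (rule integral_mono[OF primitive_on_integrable[OF yy] fyi[OF w]])
      fix s assume "s \<in> space (lebesgue_on {0..t})"
      then have "s \<in> {0..T}" using t by auto
      then have "y w s \<bullet> (G w s *v y w s) \<le> 0" using diss[OF w] by (simp add: dissipative_on_def)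
      then show "?g s \<bullet> y w s + y w s \<bullet> ?g s \<le> 2 * (y w s \<bullet> ?f w s)"
        by (simp add: inner_add_left inner_add_right inner_commute)
    qed
    finally show ?thesis .
  qed
  then have "E (\<lambda>w. (norm (y w t))\<^sup>2) \<le> E (\<lambda>w. LINT s|lebesgue_on {0..t}. 2 * (y w s \<bullet> ?f w s))" by (rule E_mono)
  also have "\<dots> = (LINT s|lebesgue_on {0..t}. E (\<lambda>w. 2 * (y w s \<bullet> ?f w s)))" by (rule E_integral[OF fyi])
  also have "\<dots> \<le> (t - 0) * (2 * (\<kappa> * h * V))"
    by (rule integral_le_interior[OF E_integrable[OF fyi]]) (use drift t in \<open>auto simp: E_cmult\<close>)
  also have "\<dots> \<le> T * (2 * (\<kappa> * h * V))"
    using t T h V0 c d(2) by (intro mult_right_mono) (auto simp: \<kappa>_def intro!: mult_nonneg_nonneg add_nonneg_nonneg divide_nonneg_nonneg)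
  finally show ?thesis by (simp add: \<kappa>_def ac_simps)
qed

section \<open>The randomized splitting\<close>

lemma time_grid_mono:
  assumes "time_grid T K t" "i \<le> j" "j \<le> K"
  shows "t i \<le> t j"
  using assms(2,3)
proof (induction j rule: dec_induct)
  case (step j)
  have "t (Suc j - 1) < t (Suc j)"
    using assms(1) step(4) unfolding time_grid_def by (metis atLeastAtMost_iff le_add1 plus_1_eq_Suc)
  with step show ?case by simp
qed simp

lemma time_grid_cell:
  assumes "time_grid T K t" "0 \<le> s" "s < T"
  obtains k where "k \<in> {1..K}" "t (k - 1) \<le> s" "s < t k"
proof -
  define k where "k = (LEAST k. s < t k)"
  have K: "s < t K" using assms by (simp add: time_grid_def)
  have "s < t k" "k \<le> K" unfolding k_def by (rule LeastI[of "\<lambda>k. s < t k", OF K], rule Least_le[of "\<lambda>k. s < t k", OF K])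
  moreover have "k \<noteq> 0" using \<open>s < t k\<close> assms(1,2) unfolding time_grid_def by (metis not_le)
  moreover have "\<not> s < t (k - 1)"
    using not_less_Least[of "k - 1" "\<lambda>k. s < t k"] \<open>k \<noteq> 0\<close> by (simp add: k_def[symmetric])
  ultimately show ?thesis using that[of k] by auto
qed

lemma split_matrix_cell:
  assumes "time_grid T K t" "k \<in> {1..K}" "t (k - 1) \<le> s" "s < t k"
  shows "split_matrix M Am S p K t w s = selected_sum M Am S p (w k)"
proof -
  have "\<not> (t (i - 1) \<le> s \<and> s < t i)" if i: "i \<in> {1..K}" "i \<noteq> k" for i
  proof (cases "i < k")
    case True
    then have "t i \<le> t (k - 1)" using assms(2) by (intro time_grid_mono[OF assms(1)]) auto
    then show ?thesis using assms(3) by simp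
  next
    case False
    then have "t k \<le> t (i - 1)" using i by (intro time_grid_mono[OF assms(1)]) auto
    then show ?thesis using assms(4) by simp
  qed
  then have "split_matrix M Am S p K t w s = (\<Sum>i=1..K. if i = k then selected_sum M Am S p (w k) else 0)"
    unfolding split_matrix_def using assms(3,4) by (intro sum.cong refl) auto
  then show ?thesis using assms(2) by simp
qed

lemma split_matrix_upd:
  assumes "\<not> (t (k - 1) \<le> s \<and> s < t k)"
  shows "split_matrix M Am S p K t (w(k := j)) s = split_matrix M Am S p K t w s"
  unfolding split_matrix_def by (intro sum.cong refl) (use assms in auto)

lemma matrix_vector_sum:
  fixes C :: "'i \<Rightarrow> real^'n^'m"
  shows "(\<Sum>i\<in>I. C i) *v x = (\<Sum>i\<in>I. C i *v x)"
  by (rule bounded_bilinear.sum_left[OF bounded_bilinear_matrix_vector_mult])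

lemma transpose_sum: "transpose (\<Sum>i\<in>I. C i) = (\<Sum>i\<in>I. transpose (C i))"
  by (simp add: transpose_def vec_eq_iff sum_component)

lemma bounded_coeff_step:
  fixes C :: "nat \<Rightarrow> real^'n^'n"
  assumes I: "\<And>k. I k \<in> sets borel" and F: "\<And>s. F s = (\<Sum>k\<in>N. if s \<in> I k then C k else 0)" and N: "finite N"
  shows "bounded_coeff T F"
proof -
  have "F = (\<lambda>s. \<Sum>k\<in>N. if s \<in> I k then C k else 0)" using F by auto
  moreover have "(\<lambda>s. \<Sum>k\<in>N. if s \<in> I k then C k else 0) \<in> borel_measurable borel"
    using I by measurable
  ultimately have "F \<in> borel_measurable (lebesgue_on {0..T})"
    by (simp add: measurable_completion measurable_restrict_space1)
  moreover have "norm (F s *v v) \<le> (\<Sum>k\<in>N. onorm ((*v) (C k))) * norm v" for s v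
  proof -
    have "norm (F s *v v) \<le> (\<Sum>k\<in>N. norm ((if s \<in> I k then C k else 0) *v v))"
      unfolding F matrix_vector_sum by (rule norm_sum)
    also have "\<dots> \<le> (\<Sum>k\<in>N. onorm ((*v) (C k)) * norm v)"
      by (rule sum_mono) (auto simp: norm_matrix_vector_le onorm_matrix_nonneg)
    finally show ?thesis by (simp add: sum_distrib_right)
  qed
  ultimately show ?thesis unfolding bounded_coeff_def by blast
qed

lemma split_matrix_coeff: "bounded_coeff T (split_matrix M Am S p K t w)"
  by (rule bounded_coeff_step[where I = "\<lambda>k. {t (k - 1)..<t k}" and N = "{1..K}"
        and C = "\<lambda>k. selected_sum M Am S p (w k)"])
     (auto simp: split_matrix_def)

lemma split_matrix_reversed_coeff: "bounded_coeff T (\<lambda>s. transpose (split_matrix M Am S p K t w (T - s)))"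
proof (rule bounded_coeff_step[where I = "\<lambda>k. {T - t k<..T - t (k - 1)}" and N = "{1..K}"
      and C = "\<lambda>k. transpose (selected_sum M Am S p (w k))"])
  have [simp]: "transpose (0::real^'n^'n) = 0" by (simp add: transpose_def vec_eq_iff)
  show "transpose (split_matrix M Am S p K t w (T - s)) =
      (\<Sum>k=1..K. if s \<in> {T - t k<..T - t (k - 1)} then transpose (selected_sum M Am S p (w k)) else 0)" for s
    unfolding split_matrix_def transpose_sum by (intro sum.cong refl) (auto simp: algebra_simps)
qed auto

lemma selected_sum_dissipative:
  assumes "subset_enumeration M S" "\<And>m x. m \<in> {1..M} \<Longrightarrow> x \<bullet> (Am m *v x) \<le> 0"
    and "\<And>m. m \<in> {1..M} \<Longrightarrow> selection_prob M S p m > 0" and j: "j \<in> {1..2^M}"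
  shows "v \<bullet> (selected_sum M Am S p j *v v) \<le> 0"
proof -
  have S: "S j \<subseteq> {1..M}" using assms(1) j unfolding subset_enumeration_def bij_betw_def by blast
  have "v \<bullet> (selected_sum M Am S p j *v v) = (\<Sum>m\<in>S j. (1 / selection_prob M S p m) * (v \<bullet> (Am m *v v)))"
    by (simp add: selected_sum_def matrix_vector_sum inner_sum_right flip: scaleR_matrix_vector_assoc)
  also have "\<dots> \<le> 0"
  proof (intro sum_nonpos mult_nonneg_nonpos)
    fix m assume "m \<in> S j"
    with S have m: "m \<in> {1..M}" by blast
    show "0 \<le> 1 / selection_prob M S p m" using assms(3)[OF m] by simp
    show "v \<bullet> (Am m *v v) \<le> 0" by (rule assms(2)[OF m])
  qed
  finally show ?thesis .
qed

lemma split_matrix_dissipative: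
  assumes "subset_enumeration M S" "\<And>m x. m \<in> {1..M} \<Longrightarrow> x \<bullet> (Am m *v x) \<le> 0"
    and "\<And>m. m \<in> {1..M} \<Longrightarrow> selection_prob M S p m > 0" and w: "w \<in> sample_space M K"
  shows "v \<bullet> (split_matrix M Am S p K t w s *v v) \<le> 0"
proof -
  have "w k \<in> {1..2^M}" if "k \<in> {1..K}" for k
    using w that unfolding sample_space_def by (rule PiE_mem)
  then show ?thesis
    unfolding split_matrix_def matrix_vector_sum inner_sum_right
    by (intro sum_nonpos) (auto intro!: selected_sum_dissipative assms)
qed

text \<open>
The weights \<open>1 / selection_prob\<close> are made for this: after exchanging the sums, each \<open>Am m\<close> is
multiplied by the total probability of the subsets containing \<open>m\<close>, divided by itself.
\<close>

lemma selected_sum_mean: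
  assumes "subset_enumeration M S" "\<And>m. m \<in> {1..M} \<Longrightarrow> selection_prob M S p m > 0"
  shows "(\<Sum>j=1..2^M. p j *\<^sub>R selected_sum M Am S p j) = (\<Sum>m=1..M. Am m)"
proof -
  have S: "S j \<subseteq> {1..M}" if "j \<in> {1..2^M}" for j
    using assms(1) that unfolding subset_enumeration_def bij_betw_def by blast
  have "(\<Sum>j=1..2^M. p j *\<^sub>R selected_sum M Am S p j)
      = (\<Sum>j=1..2^M. \<Sum>m | m \<in> {1..M} \<and> m \<in> S j. (p j / selection_prob M S p m) *\<^sub>R Am m)"
  proof (intro sum.cong refl)
    fix j assume j: "j \<in> {1..2^M::nat}"
    have "{m \<in> {1..M}. m \<in> S j} = S j" using S[OF j] by auto
    then show "p j *\<^sub>R selected_sum M Am S p j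
        = (\<Sum>m | m \<in> {1..M} \<and> m \<in> S j. (p j / selection_prob M S p m) *\<^sub>R Am m)"
      by (simp add: selected_sum_def scaleR_sum_right)
  qed
  also have "\<dots> = (\<Sum>m=1..M. \<Sum>j | j \<in> {1..2^M} \<and> m \<in> S j. (p j / selection_prob M S p m) *\<^sub>R Am m)"
    by (rule sum.swap_restrict) auto
  also have "\<dots> = (\<Sum>m=1..M. (selection_prob M S p m / selection_prob M S p m) *\<^sub>R Am m)"
    unfolding scaleR_sum_left[symmetric] sum_divide_distrib[symmetric] selection_prob_def[symmetric] by (rule refl)
  also have "\<dots> = (\<Sum>m=1..M. Am m)"
    using assms(2) by (intro sum.cong refl) (simp add: less_imp_neq[symmetric])
  finally show ?thesis .
qed

section \<open>Square integrable functions\<close>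

lemma L2_integrable_power2: "u \<in> L2 T \<Longrightarrow> integrable (lebesgue_on {0..T}) (\<lambda>s. (norm (u s))\<^sup>2)"
  by (simp add: L2_def)

lemma L2_measurable: "u \<in> L2 T \<Longrightarrow> u \<in> borel_measurable (lebesgue_on {0..T})"
  by (simp add: L2_def)

lemma L2_integrable_bound:
  fixes u :: "real \<Rightarrow> 'a::euclidean_space" and v :: "real \<Rightarrow> 'b::euclidean_space" and f :: "real \<Rightarrow> 'c::euclidean_space"
  assumes "u \<in> L2 T" "v \<in> L2 T" "f \<in> borel_measurable (lebesgue_on {0..T})"
    and "\<And>s. s \<in> {0..T} \<Longrightarrow> norm (f s) \<le> c * ((norm (u s))\<^sup>2 + (norm (v s))\<^sup>2)"
  shows "integrable (lebesgue_on {0..T}) f"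
proof (rule Bochner_Integration.integrable_bound)
  show "integrable (lebesgue_on {0..T}) (\<lambda>s. c * ((norm (u s))\<^sup>2 + (norm (v s))\<^sup>2))"
    using L2_integrable_power2[OF assms(1)] L2_integrable_power2[OF assms(2)] by simp
  show "AE s in lebesgue_on {0..T}. norm (f s) \<le> norm (c * ((norm (u s))\<^sup>2 + (norm (v s))\<^sup>2))"
    by (rule AE_I2) (use assms(4) abs_ge_self order_trans in fastforce)
qed (rule assms(3))

lemma continuous_L2:
  assumes "continuous_on {0..T} u" shows "u \<in> L2 T"
  unfolding L2_def
  by (auto intro!: measurable_continuous_interval continuous_imp_integrable_real continuous_intros assms)

lemma L2_add:
  assumes "u \<in> L2 T" "v \<in> L2 T" shows "(\<lambda>s. u s + v s) \<in> L2 T"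
proof -
  note [measurable] = L2_measurable[OF assms(1)] L2_measurable[OF assms(2)]
  have "integrable (lebesgue_on {0..T}) (\<lambda>s. (norm (u s + v s))\<^sup>2)"
  proof (rule L2_integrable_bound[OF assms, of _ 2])
    fix s
    have "(norm (u s + v s))\<^sup>2 \<le> (norm (u s) + norm (v s))\<^sup>2" by (intro power_mono norm_triangle_ineq) simp
    also have "\<dots> \<le> 2 * ((norm (u s))\<^sup>2 + (norm (v s))\<^sup>2)"
      using sum_squares_bound[of "norm (u s)" "norm (v s)"] by (simp add: power2_sum)
    finally show "norm ((norm (u s + v s))\<^sup>2) \<le> 2 * ((norm (u s))\<^sup>2 + (norm (v s))\<^sup>2)" by simp
  qed measurable
  then show ?thesis unfolding L2_def by simp
qed

lemma L2_matrix:
  fixes N :: "real^'n^'m"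
  assumes "u \<in> L2 T" shows "(\<lambda>s. N *v u s) \<in> L2 T"
proof -
  note [measurable] = L2_measurable[OF assms(1)]
  have [measurable]: "(\<lambda>s. N *v u s) \<in> borel_measurable (lebesgue_on {0..T})" by measurable
  have "integrable (lebesgue_on {0..T}) (\<lambda>s. (norm (N *v u s))\<^sup>2)"
  proof (rule L2_integrable_bound[OF assms assms, of _ "(onorm ((*v) N))\<^sup>2"])
    fix s
    have "(norm (N *v u s))\<^sup>2 \<le> (onorm ((*v) N) * norm (u s))\<^sup>2"
      by (intro power_mono norm_matrix_vector_le) simp
    also have "\<dots> \<le> (onorm ((*v) N))\<^sup>2 * ((norm (u s))\<^sup>2 + (norm (u s))\<^sup>2)"
      by (simp add: power_mult_distrib mult_left_mono)
    finally show "norm ((norm (N *v u s))\<^sup>2) \<le> (onorm ((*v) N))\<^sup>2 * ((norm (u s))\<^sup>2 + (norm (u s))\<^sup>2)" by simp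
  qed measurable
  then show ?thesis unfolding L2_def by simp
qed

lemma L2_scaleR:
  assumes "u \<in> L2 T" shows "(\<lambda>s. c *\<^sub>R u s) \<in> L2 T"
  using assms unfolding L2_def by (auto simp: power_mult_distrib)

lemma L2_diff:
  assumes "u \<in> L2 T" "v \<in> L2 T" shows "(\<lambda>s. u s - v s) \<in> L2 T"
  using L2_add[OF assms(1) L2_scaleR[OF assms(2), of "-1"]] by simp

lemma L2_integrable_norm_mult:
  assumes "u \<in> L2 T" "v \<in> L2 T" shows "integrable (lebesgue_on {0..T}) (\<lambda>s. norm (u s) * norm (v s))"
proof -
  note [measurable] = L2_measurable[OF assms(1)] L2_measurable[OF assms(2)]
  show ?thesis
  proof (rule L2_integrable_bound[OF assms, of _ 1])
    fix s
    have "2 * (norm (u s) * norm (v s)) \<le> (norm (u s))\<^sup>2 + (norm (v s))\<^sup>2"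
      using sum_squares_bound[of "norm (u s)" "norm (v s)"] by (simp add: mult.assoc)
    moreover have n: "0 \<le> norm (u s) * norm (v s)" by simp
    moreover have "a \<le> 1 * b" if "2 * a \<le> b" "0 \<le> a" for a b :: real using that by simp
    ultimately have "norm (u s) * norm (v s) \<le> 1 * ((norm (u s))\<^sup>2 + (norm (v s))\<^sup>2)" by blast
    then show "norm (norm (u s) * norm (v s)) \<le> 1 * ((norm (u s))\<^sup>2 + (norm (v s))\<^sup>2)"
      using n by (simp only: real_norm_def abs_of_nonneg)
  qed measurable
qed

lemma L2_integrable_inner:
  assumes "u \<in> L2 T" "v \<in> L2 T" shows "integrable (lebesgue_on {0..T}) (\<lambda>s. u s \<bullet> v s)"
proof -
  note [measurable] = L2_measurable[OF assms(1)] L2_measurable[OF assms(2)]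
  show ?thesis
    by (rule Bochner_Integration.integrable_bound[OF L2_integrable_norm_mult[OF assms]])
       (auto simp: Cauchy_Schwarz_ineq2 abs_mult)
qed

lemma L2_integrable:
  assumes "u \<in> L2 T" shows "integrable (lebesgue_on {0..T}) u"
proof -
  have "(\<lambda>s. 1::real) \<in> L2 T" by (rule continuous_L2) (rule continuous_on_const)
  from L2_integrable_norm_mult[OF assms this]
  have "integrable (lebesgue_on {0..T}) (\<lambda>s. norm (u s))" by simp
  from this L2_measurable[OF assms] show ?thesis by (rule integrable_norm_cancel)
qed

lemma L2_norm_nonneg: "0 \<le> L2_norm T u"
  by (simp add: L2_norm_def)

lemma L2_norm_power2: "(L2_norm T u)\<^sup>2 = (LINT s|lebesgue_on {0..T}. (norm (u s))\<^sup>2)"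
  by (simp add: L2_norm_def)

lemma L2_Cauchy_Schwarz:
  assumes "u \<in> L2 T" "v \<in> L2 T"
  shows "(LINT s|lebesgue_on {0..T}. norm (u s) * norm (v s)) \<le> L2_norm T u * L2_norm T v"
proof (rule power2_le_imp_le)
  show "(LINT s|lebesgue_on {0..T}. norm (u s) * norm (v s))\<^sup>2 \<le> (L2_norm T u * L2_norm T v)\<^sup>2"
    unfolding power_mult_distrib L2_norm_power2
    by (intro integral_Cauchy_Schwarz L2_integrable_power2 L2_integrable_norm_mult assms)
qed (simp add: L2_norm_nonneg)

lemma L2_integral_norm_le:
  assumes "u \<in> L2 T" "0 \<le> T"
  shows "(LINT s|lebesgue_on {0..T}. norm (u s)) \<le> sqrt T * L2_norm T u"
proof -
  have 1: "(\<lambda>s. 1::real) \<in> L2 T" by (rule continuous_L2) (rule continuous_on_const)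
  have "L2_norm T (\<lambda>s. 1::real) = sqrt T" using assms(2) by (simp add: L2_norm_def measure_restrict_space)
  with L2_Cauchy_Schwarz[OF assms(1) 1] show ?thesis by (simp add: mult.commute)
qed

section \<open>Optimality conditions\<close>

text \<open>
The state is chosen by Hilbert's operator, so it is a solution because some solution exists.
\<close>

lemma state_solves:
  assumes T: "0 \<le> T" and F: "bounded_coeff T F" and u: "u \<in> L2 T"
  shows "state T F B x0 u 0 = x0"
    and "primitive_on T (\<lambda>s. F s *v state T F B x0 u s + B *v u s) (state T F B x0 u)"
proof -
  obtain x where x: "x 0 = x0" "primitive_on T (\<lambda>s. F s *v x s + B *v u s) x"
    using linear_ode_exists[OF T F L2_integrable[OF L2_matrix[OF u]]] by metis
  have "solves_state T F B x0 u x"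
    using x(2) unfolding solves_state_def primitive_on_def x(1) .
  then have s: "solves_state T F B x0 u (state T F B x0 u)"
    unfolding state_def by (rule someI[of "solves_state T F B x0 u" x])
  have "{0} \<in> null_sets lebesgue" by (simp flip: negligible_iff_null_sets)
  then have "(LINT r|lebesgue_on {0..0}. F r *v state T F B x0 u r + B *v u r) = 0"
    by (simp add: integral_eq_zero_null_sets)
  moreover have i: "integrable (lebesgue_on {0..T}) (\<lambda>s. F s *v state T F B x0 u s + B *v u s)"
    and eq: "\<And>t. t \<in> {0..T} \<Longrightarrow> state T F B x0 u t
      = x0 + (LINT s|lebesgue_on {0..t}. F s *v state T F B x0 u s + B *v u s)"
    using s unfolding solves_state_def by blast+
  moreover have "state T F B x0 u 0
      = x0 + (LINT r|lebesgue_on {0..0}. F r *v state T F B x0 u r + B *v u r)"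
    by (rule eq) (use T in simp)
  ultimately show "state T F B x0 u 0 = x0" by simp
  show "primitive_on T (\<lambda>s. F s *v state T F B x0 u s + B *v u s) (state T F B x0 u)"
    by (rule primitive_onI[OF i eq])
qed

lemma first_variation_zero:
  fixes a b :: real
  assumes "\<And>l. 0 \<le> l * a + l\<^sup>2 * b"
  shows "a = 0"
proof (rule ccontr)
  assume a: "a \<noteq> 0"
  define n where "n = \<bar>b\<bar> + 1"
  have n: "0 < n" by (simp add: n_def add_nonneg_pos)
  have "(- a / n) * a + (- a / n)\<^sup>2 * b \<le> (- a / n) * a + (- a / n)\<^sup>2 * (n - 1)"
    by (intro add_left_mono mult_left_mono) (simp_all add: n_def)
  also have "\<dots> = - (a / n)\<^sup>2"
    using n by (simp add: field_simps power2_eq_square)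
  also have "\<dots> < 0" using a n by simp
  finally show False using assms[of "- a / n"] by simp
qed

lemma inner_symmetric_matrix: "transpose N = N \<Longrightarrow> x \<bullet> (N *v y) = y \<bullet> (N *v x)" for N :: "real^'n^'n"
  by (metis inner_transpose inner_commute)

text \<open>
Along the line \<open>u + l v\<close> the state is \<open>x + l z\<close>, so the cost is a quadratic polynomial in \<open>l\<close> with a
minimum at \<open>l = 0\<close>.
\<close>

lemma optimality_condition:
  fixes Q :: "real^'n^'n" and R :: "real^'q^'q" and B :: "real^'q^'n" and F :: "real \<Rightarrow> real^'n^'n"
  assumes T: "0 \<le> T" and F: "bounded_coeff T F" "dissipative_on T F" and xd: "xd \<in> L2 T"
    and sym: "transpose Q = Q" "transpose R = R"
    and u: "is_arg_min (cost T F B x0 xd Q R) (\<lambda>u. u \<in> L2 T) u" and v: "v \<in> L2 T"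
    and z: "z 0 = 0" "primitive_on T (\<lambda>s. F s *v z s + B *v v s) z"
  shows "(LINT s|lebesgue_on {0..T}. (state T F B x0 u s - xd s) \<bullet> (Q *v z s) + u s \<bullet> (R *v v s)) = 0"
proof -
  let ?x = "state T F B x0 u"
  have uL: "u \<in> L2 T" using u by (simp add: is_arg_min_def)
  note x = state_solves[OF T F(1) uL, of B x0]
  have zL: "z \<in> L2 T" by (rule continuous_L2[OF primitive_on_continuous[OF z(2)]])
  have xL: "(\<lambda>s. ?x s - xd s) \<in> L2 T"
    by (rule L2_diff[OF continuous_L2[OF primitive_on_continuous[OF x(2)]] xd])
  let ?i0 = "\<lambda>s. (?x s - xd s) \<bullet> (Q *v (?x s - xd s)) + u s \<bullet> (R *v u s)"
  let ?i1 = "\<lambda>s. (?x s - xd s) \<bullet> (Q *v z s) + u s \<bullet> (R *v v s)"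
  let ?i2 = "\<lambda>s. z s \<bullet> (Q *v z s) + v s \<bullet> (R *v v s)"
  have i: "integrable (lebesgue_on {0..T}) ?i0" "integrable (lebesgue_on {0..T}) ?i1" "integrable (lebesgue_on {0..T}) ?i2"
    by (intro Bochner_Integration.integrable_add L2_integrable_inner L2_matrix uL v zL xL)+
  have "0 \<le> l * (LINT s|lebesgue_on {0..T}. ?i1 s) + l\<^sup>2 * ((LINT s|lebesgue_on {0..T}. ?i2 s) / 2)" for l
  proof -
    let ?u = "\<lambda>s. u s + l *\<^sub>R v s"
    have u'L: "?u \<in> L2 T" by (intro L2_add L2_scaleR uL v)
    note x' = state_solves[OF T F(1) u'L, of B x0]
    have xz: "primitive_on T (\<lambda>s. F s *v (?x s + l *\<^sub>R z s) + B *v ?u s) (\<lambda>s. ?x s + l *\<^sub>R z s)"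
      by (rule primitive_on_cong[OF primitive_on_add[OF x(2) primitive_on_scaleR[OF z(2), of l]]])
         (simp_all add: matrix_vector_right_distrib matrix_vector_mult_scaleR algebra_simps)
    have st: "state T F B x0 ?u s = ?x s + l *\<^sub>R z s" if "s \<in> {0..T}" for s
      by (rule linear_ode_unique[OF F(2) x'(2) xz _ that]) (simp add: x'(1) x(1) z(1))
    have "cost T F B x0 xd Q R ?u = 1/2 * (LINT s|lebesgue_on {0..T}. ?i0 s + (2 * l) * ?i1 s + l\<^sup>2 * ?i2 s)"
      unfolding cost_def
    proof (intro arg_cong[where f = "\<lambda>a. 1/2 * a"] Bochner_Integration.integral_cong refl)
      fix s assume "s \<in> space (lebesgue_on {0..T})"
      then have s: "s \<in> {0..T}" by simp
      have "state T F B x0 ?u s - xd s = (?x s - xd s) + l *\<^sub>R z s" using st[OF s] by simp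
      then show "(state T F B x0 ?u s - xd s) \<bullet> (Q *v (state T F B x0 ?u s - xd s)) + ?u s \<bullet> (R *v ?u s)
        = ?i0 s + (2 * l) * ?i1 s + l\<^sup>2 * ?i2 s"
        using inner_symmetric_matrix[OF sym(1), of "z s" "?x s - xd s"] inner_symmetric_matrix[OF sym(2), of "v s" "u s"]
        by (simp only: matrix_vector_right_distrib matrix_vector_mult_scaleR inner_add_left inner_add_right
              inner_scaleR_left inner_scaleR_right) (simp add: algebra_simps power2_eq_square)
    qed
    also have "\<dots> = cost T F B x0 xd Q R u + l * (LINT s|lebesgue_on {0..T}. ?i1 s) + l\<^sup>2 * ((LINT s|lebesgue_on {0..T}. ?i2 s) / 2)"
      unfolding cost_def
      by (simp only: Bochner_Integration.integral_add[OF Bochner_Integration.integrable_add[OF i(1) integrable_mult_right[OF i(2)]] integrable_mult_right[OF i(3)]]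
        Bochner_Integration.integral_add[OF i(1) integrable_mult_right[OF i(2)]] integral_mult_right_zero) (simp add: algebra_simps)
    finally have "cost T F B x0 xd Q R ?u = \<dots>" .
    moreover have "\<not> cost T F B x0 xd Q R ?u < cost T F B x0 xd Q R u"
      using u u'L unfolding is_arg_min_def by blast
    ultimately show ?thesis by linarith
  qed
  then show ?thesis by (rule first_variation_zero)
qed

text \<open>
The constant is the minimum of the quadratic form on the unit sphere.
\<close>

lemma positive_definite_coercive:
  fixes R :: "real^'q^'q"
  assumes "\<And>v. v \<noteq> 0 \<Longrightarrow> v \<bullet> (R *v v) > 0"
  obtains \<alpha> where "0 < \<alpha>" "\<And>v. \<alpha> * (norm v)\<^sup>2 \<le> v \<bullet> (R *v v)"
proof -
  have "continuous_on (sphere 0 1) (\<lambda>v. v \<bullet> (R *v v))" by (intro continuous_intros)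
  moreover have "sphere (0::real^'q) 1 \<noteq> {}" by simp
  ultimately obtain v0 where v0: "v0 \<in> sphere 0 1" "\<And>v. v \<in> sphere 0 1 \<Longrightarrow> v0 \<bullet> (R *v v0) \<le> v \<bullet> (R *v v)"
    using continuous_attains_inf[OF compact_sphere] by blast
  show ?thesis
  proof
    show "0 < v0 \<bullet> (R *v v0)" using v0(1) by (intro assms) auto
    fix v :: "real^'q"
    show "v0 \<bullet> (R *v v0) * (norm v)\<^sup>2 \<le> v \<bullet> (R *v v)"
    proof (cases "v = 0")
      case False
      have "v0 \<bullet> (R *v v0) \<le> (v /\<^sub>R norm v) \<bullet> (R *v (v /\<^sub>R norm v))" by (rule v0(2)) (use False in simp)
      also have "\<dots> = (v \<bullet> (R *v v)) / (norm v)\<^sup>2"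
        by (simp add: matrix_vector_mult_scaleR power2_eq_square field_simps)
      finally show ?thesis using False by (simp add: field_simps)
    qed simp
  qed
qed

lemma integral_norm_matrix_le:
  fixes N :: "real^'n^'m"
  assumes "u \<in> L2 T"
  shows "(LINT s|lebesgue_on {0..T}. norm (N *v u s)) \<le> onorm ((*v) N) * (LINT s|lebesgue_on {0..T}. norm (u s))"
proof -
  have "(LINT s|lebesgue_on {0..T}. norm (N *v u s)) \<le> (LINT s|lebesgue_on {0..T}. onorm ((*v) N) * norm (u s))"
    by (intro integral_mono norm_matrix_vector_le integrable_norm integrable_mult_right
        L2_integrable L2_matrix assms)
  then show ?thesis by simp
qed

lemma state_bound:
  assumes "0 \<le> T" "bounded_coeff T F" "dissipative_on T F" "u \<in> L2 T" "s \<in> {0..T}"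
  shows "norm (state T F B x0 u s) \<le> norm x0 + 2 * (onorm ((*v) B) * (sqrt T * L2_norm T u))"
proof -
  note x = state_solves[OF assms(1,2,4), of B x0]
  have "norm (state T F B x0 u s) \<le> norm x0 + 2 * (LINT s|lebesgue_on {0..T}. norm (B *v u s))"
    using dissipative_bound[OF assms(3) x(2) L2_integrable[OF L2_matrix[OF assms(4)]] assms(5)] x(1) by simp
  also have "(LINT s|lebesgue_on {0..T}. norm (B *v u s)) \<le> onorm ((*v) B) * (sqrt T * L2_norm T u)"
    using integral_norm_matrix_le[OF assms(4), of B]
      mult_left_mono[OF L2_integral_norm_le[OF assms(4,1)] onorm_matrix_nonneg[of B]] by linarith
  finally show ?thesis by simp
qed

text \<open>
The minimizer is no more expensive than the zero control. For the unperturbed problem this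
bounds \<open>u\<close> by the data alone.
\<close>

lemma minimizer_L2_bound:
  fixes Q :: "real^'n^'n" and R :: "real^'q^'q" and B :: "real^'q^'n" and F :: "real \<Rightarrow> real^'n^'n"
  assumes T: "0 \<le> T" and F: "bounded_coeff T F" and xd: "xd \<in> L2 T"
    and Q: "\<And>x. x \<bullet> (Q *v x) \<ge> 0" and R: "\<And>v. \<alpha> * (norm v)\<^sup>2 \<le> v \<bullet> (R *v v)" "0 < \<alpha>"
    and u: "is_arg_min (cost T F B x0 xd Q R) (\<lambda>u. u \<in> L2 T) u"
  shows "L2_norm T u \<le> sqrt (2 / \<alpha> * cost T F B x0 xd Q R (\<lambda>_. 0))"
proof -
  let ?x = "state T F B x0 u"
  have uL: "u \<in> L2 T" using u by (simp add: is_arg_min_def)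
  have xL: "(\<lambda>s. ?x s - xd s) \<in> L2 T"
    by (rule L2_diff[OF continuous_L2[OF primitive_on_continuous[OF state_solves(2)[OF T F uL]]] xd])
  have "\<alpha> * (L2_norm T u)\<^sup>2 = (LINT s|lebesgue_on {0..T}. \<alpha> * (norm (u s))\<^sup>2)"
    by (simp add: L2_norm_power2)
  also have "\<dots> \<le> (LINT s|lebesgue_on {0..T}. (?x s - xd s) \<bullet> (Q *v (?x s - xd s)) + u s \<bullet> (R *v u s))"
  proof (rule integral_mono)
    show "integrable (lebesgue_on {0..T}) (\<lambda>s. (?x s - xd s) \<bullet> (Q *v (?x s - xd s)) + u s \<bullet> (R *v u s))"
      by (intro Bochner_Integration.integrable_add L2_integrable_inner L2_matrix uL xL)
    show "\<alpha> * (norm (u s))\<^sup>2 \<le> (?x s - xd s) \<bullet> (Q *v (?x s - xd s)) + u s \<bullet> (R *v u s)" for s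
      using Q[of "?x s - xd s"] R(1)[of "u s"] by linarith
  qed (use L2_integrable_power2[OF uL] in simp)
  also have "\<dots> = 2 * cost T F B x0 xd Q R u" by (simp add: cost_def)
  also have "\<dots> \<le> 2 * cost T F B x0 xd Q R (\<lambda>_. 0)"
  proof -
    have "(\<lambda>_. 0) \<in> L2 T" by (rule continuous_L2) (rule continuous_on_const)
    then have "\<not> cost T F B x0 xd Q R (\<lambda>_. 0) < cost T F B x0 xd Q R u"
      using u unfolding is_arg_min_def by blast
    then show ?thesis by simp
  qed
  finally have "(L2_norm T u)\<^sup>2 \<le> 2 / \<alpha> * cost T F B x0 xd Q R (\<lambda>_. 0)"
    using R(2) by (simp add: field_simps)
  then show ?thesis by (rule real_le_rsqrt)
qed

section \<open>The control error\<close>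

text \<open>
Everything here concerns one fixed sample, with coefficient \<open>F\<close>. The optimality conditions of both
minimizers are tested with the same direction \<open>e = u - u0\<close> and subtracted. Since the state of \<open>u\<close> is
the state of \<open>u0\<close> plus the response \<open>zh\<close> to \<open>e\<close>, the difference contains the quadratic form of \<open>R\<close> at \<open>e\<close> (coercive) and that of \<open>Q\<close>
at \<open>zh\<close> (nonnegative). Of the two remaining terms, one is linear in the state error, and the other one
compares the responses of the two systems to \<open>e\<close>. That one is rewritten with the adjoint states,
because \<open>e\<close> depends on the sample whereas both adjoint states are driven by the same deterministic
right-hand side \<open>Q (x - xd)\<close>.
\<close>

lemma control_error:
  fixes A Q :: "real^'n^'n" and R :: "real^'q^'q" and B :: "real^'q^'n" and F :: "real \<Rightarrow> real^'n^'n"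
    and x0 :: "real^'n"
  defines "b \<equiv> onorm ((*v) B)" and "q \<equiv> onorm ((*v) Q)"
  assumes T: "0 \<le> T" and A: "dissipative_on T (\<lambda>_. A)" and F: "bounded_coeff T F" "dissipative_on T F"
    and xd: "xd \<in> L2 T" and sym: "transpose Q = Q" "transpose R = R"
    and Q: "\<And>x. x \<bullet> (Q *v x) \<ge> 0" and R: "\<And>v. \<alpha> * (norm v)\<^sup>2 \<le> v \<bullet> (R *v v)" "0 < \<alpha>"
    and u0: "is_arg_min (cost T (\<lambda>_. A) B x0 xd Q R) (\<lambda>u. u \<in> L2 T) u0"
    and u: "is_arg_min (cost T F B x0 xd Q R) (\<lambda>u. u \<in> L2 T) u"
    and x_def: "x = state T (\<lambda>_. A) B x0 u0"
    and \<phi>: "primitive_on T (\<lambda>s. transpose A *v \<phi> s + Q *v (x (T - s) - xd (T - s))) \<phi>" "\<phi> 0 = 0"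
    and \<phi>h: "primitive_on T (\<lambda>s. transpose (F (T - s)) *v \<phi>h s + Q *v (x (T - s) - xd (T - s))) \<phi>h" "\<phi>h 0 = 0"
  shows "(L2_norm T (\<lambda>s. u s - u0 s))\<^sup>2
    \<le> 8 * q\<^sup>2 * b\<^sup>2 * T\<^sup>2 / \<alpha>\<^sup>2 * (L2_norm T (\<lambda>s. state T F B x0 u0 s - x s))\<^sup>2
      + 2 * b\<^sup>2 / \<alpha>\<^sup>2 * (L2_norm T (\<lambda>s. \<phi>h s - \<phi> s))\<^sup>2"
proof -
  let ?I = "\<lambda>f::real \<Rightarrow> real. integral\<^sup>L (lebesgue_on {0..T}) f"
  have b: "0 \<le> b" and q: "0 \<le> q" unfolding b_def q_def by (rule onorm_matrix_nonneg)+
  have u0L: "u0 \<in> L2 T" and uL: "u \<in> L2 T" using u0 u by (simp_all add: is_arg_min_def)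
  define e where "e s = u s - u0 s" for s
  have eL: "e \<in> L2 T" unfolding e_def[abs_def] by (rule L2_diff[OF uL u0L])
  note Be = L2_integrable[OF L2_matrix[OF eL, of B]]
  define xh where "xh = state T F B x0 u0"
  define y where "y s = xh s - x s" for s
  define \<psi> where "\<psi> s = \<phi>h s - \<phi> s" for s
  obtain z where z: "z 0 = 0" "primitive_on T (\<lambda>s. A *v z s + B *v e s) z"
    using linear_ode_exists[OF T bounded_coeff_const Be] by metis
  obtain zh where zh: "zh 0 = 0" "primitive_on T (\<lambda>s. F s *v zh s + B *v e s) zh"
    using linear_ode_exists[OF T F(1) Be] by metis
  note x = state_solves[OF T bounded_coeff_const[of T A] u0L, of B x0, folded x_def]
  note xh = state_solves[OF T F(1) u0L, of B x0, folded xh_def]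
  note xu = state_solves[OF T F(1) uL, of B x0]
  have xL: "(\<lambda>s. x s - xd s) \<in> L2 T"
    by (rule L2_diff[OF continuous_L2[OF primitive_on_continuous[OF x(2)]] xd])
  have yL: "y \<in> L2 T" unfolding y_def[abs_def]
    by (intro L2_diff continuous_L2 primitive_on_continuous[OF x(2)] primitive_on_continuous[OF xh(2)])
  have zL: "z \<in> L2 T" "zh \<in> L2 T"
    by (intro continuous_L2 primitive_on_continuous[OF z(2)] primitive_on_continuous[OF zh(2)])+
  have r: "primitive_on T (\<lambda>s. - (transpose A *v \<phi> (T - s) + Q *v (x s - xd s))) (\<lambda>s. \<phi> (T - s))"
    "primitive_on T (\<lambda>s. - (transpose (F s) *v \<phi>h (T - s) + Q *v (x s - xd s))) (\<lambda>s. \<phi>h (T - s))"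
    using primitive_on_reflect[OF \<phi>(1)] primitive_on_reflect[OF \<phi>h(1)] by simp_all
  have \<phi>L: "(\<lambda>s. \<phi> (T - s)) \<in> L2 T" "(\<lambda>s. \<phi>h (T - s)) \<in> L2 T"
    by (intro continuous_L2 primitive_on_continuous[OF r(1)] primitive_on_continuous[OF r(2)])+
  have \<psi>L: "(\<lambda>s. \<psi> (T - s)) \<in> L2 T"
    unfolding \<psi>_def by (rule L2_diff[OF \<phi>L(2,1)])
  have split_u: "state T F B x0 u s = x s + y s + zh s" if "s \<in> {0..T}" for s
  proof -
    have "primitive_on T (\<lambda>s. F s *v (xh s + zh s) + B *v u s) (\<lambda>s. xh s + zh s)"
      by (rule primitive_on_cong[OF primitive_on_add[OF xh(2) zh(2)]])
         (simp_all add: e_def matrix_vector_right_distrib matrix_vector_mult_diff_distrib)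
    from linear_ode_unique[OF F(2) xu(2) this _ that] show ?thesis
      by (simp add: xu(1) xh(1) zh(1) y_def)
  qed
  have opt0: "?I (\<lambda>s. (x s - xd s) \<bullet> (Q *v z s) + u0 s \<bullet> (R *v e s)) = 0"
    unfolding x_def by (rule optimality_condition[OF T bounded_coeff_const A xd sym u0 eL z])
  have "?I (\<lambda>s. (state T F B x0 u s - xd s) \<bullet> (Q *v zh s) + u s \<bullet> (R *v e s)) = 0"
    by (rule optimality_condition[OF T F xd sym u eL zh])
  also have "?I (\<lambda>s. (state T F B x0 u s - xd s) \<bullet> (Q *v zh s) + u s \<bullet> (R *v e s))
      = ?I (\<lambda>s. (((Q *v (x s - xd s)) \<bullet> zh s + y s \<bullet> (Q *v zh s)) + zh s \<bullet> (Q *v zh s))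
          + (u0 s \<bullet> (R *v e s) + e s \<bullet> (R *v e s)))"
  proof (intro Bochner_Integration.integral_cong refl)
    fix s assume "s \<in> space (lebesgue_on {0..T})"
    then have s: "s \<in> {0..T}" by simp
    have st: "state T F B x0 u s - xd s = (x s - xd s) + y s + zh s" "u s = u0 s + e s"
      using split_u[OF s] by (simp_all add: e_def)
    have "(Q *v (x s - xd s)) \<bullet> zh s = (x s - xd s) \<bullet> (Q *v zh s)"
      by (metis inner_transpose sym(1))
    then show "(state T F B x0 u s - xd s) \<bullet> (Q *v zh s) + u s \<bullet> (R *v e s) =
       (((Q *v (x s - xd s)) \<bullet> zh s + y s \<bullet> (Q *v zh s)) + zh s \<bullet> (Q *v zh s))
          + (u0 s \<bullet> (R *v e s) + e s \<bullet> (R *v e s))"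
      unfolding st by (simp only: inner_add_left)
  qed
  also have "\<dots> = ((?I (\<lambda>s. (Q *v (x s - xd s)) \<bullet> zh s) + ?I (\<lambda>s. y s \<bullet> (Q *v zh s))) + ?I (\<lambda>s. zh s \<bullet> (Q *v zh s)))
      + (?I (\<lambda>s. u0 s \<bullet> (R *v e s)) + ?I (\<lambda>s. e s \<bullet> (R *v e s)))"
  proof -
    have i: "integrable (lebesgue_on {0..T}) (\<lambda>s. (Q *v (x s - xd s)) \<bullet> zh s)"
      "integrable (lebesgue_on {0..T}) (\<lambda>s. y s \<bullet> (Q *v zh s))"
      "integrable (lebesgue_on {0..T}) (\<lambda>s. zh s \<bullet> (Q *v zh s))"
      "integrable (lebesgue_on {0..T}) (\<lambda>s. u0 s \<bullet> (R *v e s))"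
      "integrable (lebesgue_on {0..T}) (\<lambda>s. e s \<bullet> (R *v e s))"
      by (intro L2_integrable_inner L2_matrix xL yL zL u0L eL)+
    show ?thesis
      by (subst Bochner_Integration.integral_add[OF Bochner_Integration.integrable_add[OF Bochner_Integration.integrable_add[OF i(1,2)] i(3)]
                Bochner_Integration.integrable_add[OF i(4,5)]],
          subst Bochner_Integration.integral_add[OF Bochner_Integration.integrable_add[OF i(1,2)] i(3)],
          subst Bochner_Integration.integral_add[OF i(1,2)], subst Bochner_Integration.integral_add[OF i(4,5)]) (rule refl)
  qed
  also have "?I (\<lambda>s. (Q *v (x s - xd s)) \<bullet> zh s) = ?I (\<lambda>s. \<phi>h (T - s) \<bullet> (B *v e s))"
    by (rule adjoint_duality[OF T \<phi>h zh(2,1) L2_integrable[OF L2_matrix[OF xL]] Be])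
  finally have opt: "?I (\<lambda>s. \<phi>h (T - s) \<bullet> (B *v e s)) + ?I (\<lambda>s. y s \<bullet> (Q *v zh s)) + ?I (\<lambda>s. zh s \<bullet> (Q *v zh s))
      + (?I (\<lambda>s. u0 s \<bullet> (R *v e s)) + ?I (\<lambda>s. e s \<bullet> (R *v e s))) = 0" .
  have "?I (\<lambda>s. (x s - xd s) \<bullet> (Q *v z s) + u0 s \<bullet> (R *v e s))
      = ?I (\<lambda>s. (Q *v (x s - xd s)) \<bullet> z s) + ?I (\<lambda>s. u0 s \<bullet> (R *v e s))"
  proof -
    have "(x s - xd s) \<bullet> (Q *v z s) = (Q *v (x s - xd s)) \<bullet> z s" for s
      by (metis inner_transpose sym(1))
    then show ?thesis
      by (simp only:) (intro Bochner_Integration.integral_add L2_integrable_inner L2_matrix xL zL u0L eL)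
  qed
  also have "?I (\<lambda>s. (Q *v (x s - xd s)) \<bullet> z s) = ?I (\<lambda>s. \<phi> (T - s) \<bullet> (B *v e s))"
    by (rule adjoint_duality[OF T \<phi> z(2,1) L2_integrable[OF L2_matrix[OF xL]] Be])
  finally have opt0': "?I (\<lambda>s. \<phi> (T - s) \<bullet> (B *v e s)) + ?I (\<lambda>s. u0 s \<bullet> (R *v e s)) = 0"
    using opt0 by simp
  have \<psi>e: "?I (\<lambda>s. \<psi> (T - s) \<bullet> (B *v e s))
      = ?I (\<lambda>s. \<phi>h (T - s) \<bullet> (B *v e s)) - ?I (\<lambda>s. \<phi> (T - s) \<bullet> (B *v e s))"
    unfolding \<psi>_def inner_diff_left
    by (intro Bochner_Integration.integral_diff L2_integrable_inner L2_matrix \<phi>L eL)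
  define N where "N = L2_norm T e"
  have N: "0 \<le> N" by (simp add: N_def L2_norm_nonneg)
  have zQ: "0 \<le> ?I (\<lambda>s. zh s \<bullet> (Q *v zh s))" by (intro Bochner_Integration.integral_nonneg Q)
  have "\<alpha> * N\<^sup>2 = ?I (\<lambda>s. \<alpha> * (norm (e s))\<^sup>2)" by (simp add: N_def L2_norm_power2)
  also have "\<dots> \<le> ?I (\<lambda>s. e s \<bullet> (R *v e s))"
    using L2_integrable_power2[OF eL] R(1) by (intro integral_mono L2_integrable_inner L2_matrix eL) auto
  also have "\<dots> \<le> - ?I (\<lambda>s. y s \<bullet> (Q *v zh s)) - ?I (\<lambda>s. \<psi> (T - s) \<bullet> (B *v e s))"
    using opt opt0' \<psi>e zQ by linarith
  finally have energy: "\<alpha> * N\<^sup>2 \<le> - ?I (\<lambda>s. y s \<bullet> (Q *v zh s)) - ?I (\<lambda>s. \<psi> (T - s) \<bullet> (B *v e s))" .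
  have state_part: "- ?I (\<lambda>s. y s \<bullet> (Q *v zh s)) \<le> (2 * b * sqrt T * N * q) * (sqrt T * L2_norm T y)"
  proof -
    have zb: "norm (zh s) \<le> 2 * b * sqrt T * N" if s: "s \<in> {0..T}" for s
    proof -
      have "norm (zh s) \<le> 2 * (LINT s|lebesgue_on {0..T}. norm (B *v e s))"
        using dissipative_bound[OF F(2) zh(2) Be s] zh(1) by simp
      also have "\<dots> \<le> 2 * (b * (sqrt T * N))"
        using integral_norm_matrix_le[OF eL, of B] mult_left_mono[OF L2_integral_norm_le[OF eL T] b]
        by (simp add: b_def N_def)
      finally show ?thesis by (simp add: ac_simps)
    qed
    have "- ?I (\<lambda>s. y s \<bullet> (Q *v zh s)) = ?I (\<lambda>s. - (y s \<bullet> (Q *v zh s)))" by simp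
    also have "\<dots> \<le> ?I (\<lambda>s. (2 * b * sqrt T * N * q) * norm (y s))"
    proof (rule integral_mono)
      show "integrable (lebesgue_on {0..T}) (\<lambda>s. - (y s \<bullet> (Q *v zh s)))"
        by (intro Bochner_Integration.integrable_minus L2_integrable_inner L2_matrix yL zL)
      fix s assume "s \<in> space (lebesgue_on {0..T})"
      then have s: "s \<in> {0..T}" by simp
      have "- (y s \<bullet> (Q *v zh s)) \<le> norm (y s) * norm (Q *v zh s)"
        using Cauchy_Schwarz_ineq2[of "y s" "Q *v zh s"] by linarith
      also have "\<dots> \<le> norm (y s) * (q * (2 * b * sqrt T * N))"
        using order_trans[OF norm_matrix_vector_le[of Q "zh s", folded q_def] mult_left_mono[OF zb[OF s] q]]
        by (rule mult_left_mono) simp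
      finally show "- (y s \<bullet> (Q *v zh s)) \<le> (2 * b * sqrt T * N * q) * norm (y s)"
        by (simp add: ac_simps)
    qed (use L2_integrable[OF yL] in simp)
    also have "\<dots> = (2 * b * sqrt T * N * q) * ?I (\<lambda>s. norm (y s))" by simp
    also have "\<dots> \<le> (2 * b * sqrt T * N * q) * (sqrt T * L2_norm T y)"
      using b q N T by (intro mult_left_mono L2_integral_norm_le yL) auto
    finally show ?thesis .
  qed
  have adjoint_part: "- ?I (\<lambda>s. \<psi> (T - s) \<bullet> (B *v e s)) \<le> b * (L2_norm T \<psi> * N)"
  proof -
    have "- ?I (\<lambda>s. \<psi> (T - s) \<bullet> (B *v e s)) = ?I (\<lambda>s. - (\<psi> (T - s) \<bullet> (B *v e s)))" by simp
    also have "\<dots> \<le> ?I (\<lambda>s. b * (norm (\<psi> (T - s)) * norm (e s)))"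
    proof (rule integral_mono)
      show "integrable (lebesgue_on {0..T}) (\<lambda>s. - (\<psi> (T - s) \<bullet> (B *v e s)))"
        by (intro Bochner_Integration.integrable_minus L2_integrable_inner L2_matrix \<psi>L eL)
      fix s 
      have "- (\<psi> (T - s) \<bullet> (B *v e s)) \<le> norm (\<psi> (T - s)) * norm (B *v e s)"
        using Cauchy_Schwarz_ineq2[of "\<psi> (T - s)" "B *v e s"] by linarith
      also have "\<dots> \<le> norm (\<psi> (T - s)) * (b * norm (e s))"
        unfolding b_def by (intro mult_left_mono norm_matrix_vector_le) simp
      finally show "- (\<psi> (T - s) \<bullet> (B *v e s)) \<le> b * (norm (\<psi> (T - s)) * norm (e s))" by (simp add: ac_simps)
    qed (use L2_integrable_norm_mult[OF \<psi>L eL] in simp)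
    also have "\<dots> = b * ?I (\<lambda>s. norm (\<psi> (T - s)) * norm (e s))" by simp
    also have "\<dots> \<le> b * (L2_norm T (\<lambda>s. \<psi> (T - s)) * N)"
      unfolding N_def by (intro mult_left_mono L2_Cauchy_Schwarz \<psi>L eL b)
    also have "L2_norm T (\<lambda>s. \<psi> (T - s)) = L2_norm T \<psi>"
    proof -
      have "continuous_on {0..T} \<psi>" unfolding \<psi>_def[abs_def]
        by (intro continuous_on_diff primitive_on_continuous[OF \<phi>(1)] primitive_on_continuous[OF \<phi>h(1)])
      then have "integrable (lebesgue_on {0..T}) (\<lambda>s. (norm (\<psi> s))\<^sup>2)"
        by (intro continuous_imp_integrable_real continuous_intros)
      from integral_reflect[OF this, of T] show ?thesis by (simp add: L2_norm_def)
    qed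
    finally show ?thesis .
  qed
  have "\<alpha> * N\<^sup>2 \<le> (2 * b * sqrt T * N * q) * (sqrt T * L2_norm T y) + b * (L2_norm T \<psi> * N)"
    using energy state_part adjoint_part by linarith
  also have "\<dots> = N * (2 * q * b * (sqrt T * sqrt T) * L2_norm T y + b * L2_norm T \<psi>)"
    by (simp only: algebra_simps)
  also have "sqrt T * sqrt T = T" using T by simp
  finally have "\<alpha> * N\<^sup>2 \<le> N * (2 * q * b * T * L2_norm T y + b * L2_norm T \<psi>)" .
  then have *: "\<alpha> * N \<le> 2 * q * b * T * L2_norm T y + b * L2_norm T \<psi>"
    using N b q T by (cases "N = 0") (auto simp: power2_eq_square L2_norm_nonneg mult.left_commute)
  have "(\<alpha> * N)\<^sup>2 \<le> (2 * q * b * T * L2_norm T y + b * L2_norm T \<psi>)\<^sup>2"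
    using R(2) N by (intro power_mono[OF *]) simp
  also have "\<dots> \<le> 2 * (2 * q * b * T * L2_norm T y)\<^sup>2 + 2 * (b * L2_norm T \<psi>)\<^sup>2"
    using sum_squares_bound[of "2 * q * b * T * L2_norm T y" "b * L2_norm T \<psi>"] by (simp add: power2_sum)
  finally have "N\<^sup>2 * \<alpha>\<^sup>2 \<le> 8 * q\<^sup>2 * b\<^sup>2 * T\<^sup>2 * (L2_norm T y)\<^sup>2 + 2 * b\<^sup>2 * (L2_norm T \<psi>)\<^sup>2"
    by (simp add: power_mult_distrib ac_simps)
  then have "N\<^sup>2 \<le> (8 * q\<^sup>2 * b\<^sup>2 * T\<^sup>2 * (L2_norm T y)\<^sup>2 + 2 * b\<^sup>2 * (L2_norm T \<psi>)\<^sup>2) / \<alpha>\<^sup>2"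
    using R(2) by (simp add: pos_le_divide_eq)
  then show ?thesis
    by (simp add: N_def e_def[abs_def] y_def[abs_def] xh_def \<psi>_def[abs_def] add_divide_distrib)
qed

theorem mainTheorem4:
  fixes A Q :: "real^'n^'n" and B :: "real^'q^'n" and R :: "real^'q^'q"
    and x0 :: "real^'n" and T :: real and xd :: "real \<Rightarrow> real^'n"
  assumes "T > 0"
    and "xd \<in> L2 T"
    and "transpose Q = Q" and "\<And>x. x \<bullet> (Q *v x) \<ge> 0"
    and "transpose R = R" and "\<And>v. v \<noteq> 0 \<Longrightarrow> v \<bullet> (R *v v) > 0"
  shows "\<exists>C::real. \<forall>(M::nat) (Am :: nat \<Rightarrow> real^'n^'n) (S :: nat \<Rightarrow> nat set) (p :: nat \<Rightarrow> real)
           (K::nat) (t :: nat \<Rightarrow> real) (ustar :: real \<Rightarrow> real^'q) (uh :: (nat \<Rightarrow> nat) \<Rightarrow> real \<Rightarrow> real^'q).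
           A = (\<Sum>m=1..M. Am m) \<longrightarrow>
           subset_enumeration M S \<longrightarrow>
           (\<forall>\<omega>\<in>{1..2^M}. p \<omega> \<ge> 0) \<longrightarrow>
           time_grid T K t \<longrightarrow>
           (\<forall>m\<in>{1..M}. \<forall>x. x \<bullet> (Am m *v x) \<le> 0) \<longrightarrow>
           (\<Sum>\<omega>=1..2^M. p \<omega>) = 1 \<longrightarrow>
           (\<forall>m\<in>{1..M}. selection_prob M S p m > 0) \<longrightarrow>
           is_arg_min (cost T (\<lambda>_. A) B x0 xd Q R) (\<lambda>u. u \<in> L2 T) ustar \<longrightarrow>
           (\<forall>\<omega>\<in>sample_space M K.
              is_arg_min (cost T (split_matrix M Am S p K t \<omega>) B x0 xd Q R) (\<lambda>u. u \<in> L2 T) (uh \<omega>)) \<longrightarrow>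
           expect M p K (\<lambda>\<omega>. (L2_norm T (\<lambda>s. uh \<omega> s - ustar s))\<^sup>2)
             \<le> C * max_spacing K t * splitting_variance M Am S p A"
proof -
  note xd = assms(2) and symQ = assms(3) and Q = assms(4) and symR = assms(5)
  have T: "0 \<le> T" and T': "0 < T" using assms(1) by simp_all
  obtain \<alpha> where \<alpha>: "0 < \<alpha>" "\<And>v. \<alpha> * (norm v)\<^sup>2 \<le> v \<bullet> (R *v v)"
    using positive_definite_coercive[OF assms(6)] by metis
  define b where "b = onorm ((*v) B)"
  define q where "q = onorm ((*v) Q)"
  define d where "d = onorm ((*v) A)"
  have bqd: "0 \<le> b" "0 \<le> q" "0 \<le> d" unfolding b_def q_def d_def by (rule onorm_matrix_nonneg)+
  \<comment> \<open>\<open>c1\<close> bounds the states: their source \<open>B u\<^sup>*\<close> is controlled through the cost of the zero control.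
    \<open>c2\<close> bounds the adjoint states, whose source is \<open>Q (x - xd)\<close>. The estimate for the mean square error
    has the factor \<open>\<kappa> c1\<close> forwards and \<open>\<kappa> c2\<close> backwards.\<close>
  define c1 where "c1 = norm x0 + 2 * (b * (sqrt T * sqrt (2 / \<alpha> * cost T (\<lambda>_. A) B x0 xd Q R (\<lambda>_. 0))))"
  define c2 where "c2 = 2 * (q * (T * c1 + (LINT s|lebesgue_on {0..T}. norm (xd s))))"
  define \<kappa> where "\<kappa> c = 2 * T * (c\<^sup>2 + c * d * (1 + 4 * T\<^sup>2 * c\<^sup>2) / 2)" for c
  define C where "C = 8 * q\<^sup>2 * b\<^sup>2 * T\<^sup>2 / \<alpha>\<^sup>2 * (T * \<kappa> c1) + 2 * b\<^sup>2 / \<alpha>\<^sup>2 * (T * \<kappa> c2)"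
  show ?thesis
  proof (rule exI[of _ C], intro allI impI)
    fix M Am S p K t and u0 :: "real \<Rightarrow> real^'q" and uh :: "(nat \<Rightarrow> nat) \<Rightarrow> real \<Rightarrow> real^'q"
    assume A: "A = (\<Sum>m=1..M. Am m)" and S: "subset_enumeration M S"
      and p: "\<forall>j\<in>{1..2^M}. p j \<ge> 0" "(\<Sum>j=1..2^M. p j) = 1"
      and grid: "time_grid T K t" and Am: "\<forall>m\<in>{1..M}. \<forall>x. x \<bullet> (Am m *v x) \<le> 0"
      and sel: "\<forall>m\<in>{1..M}. selection_prob M S p m > 0"
      and u0: "is_arg_min (cost T (\<lambda>_. A) B x0 xd Q R) (\<lambda>u. u \<in> L2 T) u0"
      and uh: "\<forall>w\<in>sample_space M K.
              is_arg_min (cost T (split_matrix M Am S p K t w) B x0 xd Q R) (\<lambda>u. u \<in> L2 T) (uh w)"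
    have weights: "subset_weights M p" using p by unfold_locales auto
    interpret subset_weights M K p by (rule weights)
    define F where "F = split_matrix M Am S p K t"
    define g where "g = selected_sum M Am S p"
    define h where "h = max_spacing K t"
    define V where "V = splitting_variance M Am S p A"
    define \<delta> where "\<delta> j = onorm ((*v) (g j - A))" for j
    have \<delta>0: "0 \<le> \<delta> j" for j unfolding \<delta>_def by (rule onorm_matrix_nonneg)
    have V: "V = (\<Sum>j=1..2^M. (\<delta> j)\<^sup>2 * p j)"
      by (simp add: V_def splitting_variance_def \<delta>_def g_def)
    have spacing: "t k - t (k - 1) \<le> h" if "k \<in> {1..K}" for k
      unfolding h_def max_spacing_def by (rule Max_ge) (use that in auto)
    have h: "0 \<le> h"
    proof -
      obtain k where k: "k \<in> {1..K}" "t (k - 1) \<le> 0" "0 < t k"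
        using time_grid_cell[OF grid order_refl T'] by metis
      then show ?thesis using spacing[OF k(1)] by linarith
    qed
    have mean: "(\<Sum>j=1..2^M. p j *\<^sub>R g j) = A"
      unfolding A g_def by (rule selected_sum_mean[OF S]) (use sel in auto)
    have A_diss: "dissipative_on T (\<lambda>_. A)"
      unfolding dissipative_on_def A matrix_vector_sum inner_sum_right
      by (intro ballI allI sum_nonpos) (use Am in auto)
    have F_neg: "v \<bullet> (F w s *v v) \<le> 0" if "w \<in> \<Omega>" for w s v
      unfolding F_def by (rule split_matrix_dissipative[OF S _ _ that]) (use Am sel in auto)
    have F_diss: "dissipative_on T (F w)" if "w \<in> \<Omega>" for w
      using F_neg[OF that] by (simp add: dissipative_on_def)
    have F_coeff: "bounded_coeff T (F w)" for w unfolding F_def by (rule split_matrix_coeff)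
    have F_cell: "F w s = g (w k)" if "k \<in> {1..K}" "t (k - 1) \<le> s" "s < t k" for w k s
      unfolding F_def g_def by (rule split_matrix_cell[OF grid that])
    have F_upd: "F (w(k := j)) s = F w s" if "\<not> (t (k - 1) \<le> s \<and> s < t k)" for w k j s
      unfolding F_def by (rule split_matrix_upd[OF that])
    have A'_diss: "dissipative_on T (\<lambda>_. transpose A)"
      using A_diss by (metis dissipative_on_def inner_commute inner_transpose)
    have F'_diss: "dissipative_on T (\<lambda>s. transpose (F w (T - s)))" if "w \<in> \<Omega>" for w
      using F_neg[OF that] unfolding dissipative_on_def by (metis inner_commute inner_transpose)
    have F'_coeff: "bounded_coeff T (\<lambda>s. transpose (F w (T - s)))" for w
      unfolding F_def by (rule split_matrix_reversed_coeff)
    have u0L: "u0 \<in> L2 T" using u0 by (simp add: is_arg_min_def)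
    have u0b: "L2_norm T u0 \<le> sqrt (2 / \<alpha> * cost T (\<lambda>_. A) B x0 xd Q R (\<lambda>_. 0))"
      by (rule minimizer_L2_bound[OF T bounded_coeff_const xd Q \<alpha>(2,1) u0])
    have c1: "norm (state T G B x0 u0 s) \<le> c1" if "bounded_coeff T G" "dissipative_on T G" "s \<in> {0..T}" for G s
    proof -
      have "b * (sqrt T * L2_norm T u0) \<le> b * (sqrt T * sqrt (2 / \<alpha> * cost T (\<lambda>_. A) B x0 xd Q R (\<lambda>_. 0)))"
        by (intro mult_left_mono u0b) (use bqd T in auto)
      then show ?thesis using state_bound[OF T that(1,2) u0L that(3), of B x0] by (simp add: c1_def b_def)
    qed

    \<comment> \<open>The state error: the cell of \<open>s\<close> starts at \<open>t (k - 1)\<close>, where the state depends on the earlier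
      indices only.\<close>
    define x where "x = state T (\<lambda>_. A) B x0 u0"
    define xh where "xh w = state T (F w) B x0 u0" for w
    note x = state_solves[OF T bounded_coeff_const[of T A] u0L, of B x0, folded x_def]
    have xh: "xh w 0 = x0" "primitive_on T (\<lambda>s. F w s *v xh w s + B *v u0 s) (xh w)" for w
      unfolding xh_def by (rule state_solves[OF T F_coeff u0L])+
    have cx: "continuous_on {0..T} x" by (rule primitive_on_continuous[OF x(2)])
    have forward: "E (\<lambda>w. (norm (xh w s - x s))\<^sup>2) \<le> \<kappa> c1 * h * V" if s: "s \<in> {0..T}" for s
      unfolding \<kappa>_def
    proof (rule random_perturbation_estimate[where G = F and g = g and D = A and \<delta> = \<delta> and x = x
          and y = "\<lambda>w s. xh w s - x s", OF weights T' h F_diss F_coeff _ _ cx _ _ _ mean _ \<delta>0 _ bqd(3) V s])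
      fix w assume w: "w \<in> \<Omega>"
      show "primitive_on T (\<lambda>s. F w s *v (xh w s - x s) + (F w s - A) *v x s) (\<lambda>s. xh w s - x s)"
        by (rule primitive_on_cong[OF primitive_on_diff[OF xh(2) x(2)]])
           (simp_all add: matrix_vector_mult_diff_distrib matrix_vector_mult_diff_rdistrib)
      show "norm (x s + (xh w s - x s)) \<le> c1" if "s \<in> {0..T}" for s
        using c1[OF F_coeff F_diss[OF w] that] by (simp add: xh_def)
    next
      fix s assume s: "0 < s" "s < T"
      obtain k where k: "k \<in> {1..K}" "t (k - 1) \<le> s" "s < t k"
        using time_grid_cell[OF grid _ s(2)] s(1) by (metis less_imp_le)
      show "\<exists>k\<in>{1..K}. \<exists>a\<in>{0..s}. s - a \<le> h \<and>
        (\<forall>w\<in>\<Omega>. F w s = g (w k) \<and> (\<forall>r. a < r \<longrightarrow> r < s \<longrightarrow> F w r = g (w k)) \<and>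
           (\<forall>j\<in>{1..2^M}. xh (w(k := j)) a - x a = xh w a - x a))"
      proof (rule bexI[OF _ k(1)], rule bexI[of _ "t (k - 1)"], intro conjI ballI allI impI)
        show "s - t (k - 1) \<le> h" using spacing[OF k(1)] k(3) by linarith
        have "t 0 \<le> t (k - 1)" by (rule time_grid_mono[OF grid]) (use k(1) in auto)
        then show a: "t (k - 1) \<in> {0..s}" using grid k(2) by (simp add: time_grid_def)
        fix w assume w: "w \<in> \<Omega>"
        show "F w s = g (w k)" by (rule F_cell[OF k])
        show "F w r = g (w k)" if "t (k - 1) < r" "r < s" for r
          by (rule F_cell[OF k(1)]) (use that k(3) in auto)
        fix j 
        have "xh w (t (k - 1)) = xh (w(k := j)) (t (k - 1))"
          by (rule linear_ode_local[OF F_diss[OF w] _ xh(2) xh(2)])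
             (use a s xh(1) in \<open>auto simp: F_upd\<close>)
        then show "xh (w(k := j)) (t (k - 1)) - x (t (k - 1)) = xh w (t (k - 1)) - x (t (k - 1))" by simp
      qed
    qed (use c1[OF bounded_coeff_const A_diss] norm_matrix_vector_le in \<open>auto simp: x_def xh(1) x(1)[unfolded x_def] \<delta>_def d_def\<close>)

    \<comment> \<open>The adjoint error, in reversed time: the cell of \<open>T - s\<close> is entered at its right end, that is at the
      reversed time \<open>T - t k\<close>, where the adjoint state depends on the later indices only.\<close>
    define f where "f s = Q *v (x s - xd s)" for s
    have xL: "(\<lambda>s. x s - xd s) \<in> L2 T" by (rule L2_diff[OF continuous_L2[OF cx] xd])
    have fi: "integrable (lebesgue_on {0..T}) f"
      unfolding f_def[abs_def] by (rule L2_integrable[OF L2_matrix[OF xL]])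
    have fi': "integrable (lebesgue_on {0..T}) (\<lambda>s. f (T - s))"
      using integrable_reflect[OF fi, of T] by simp
    have f_bound: "2 * (LINT s|lebesgue_on {0..T}. norm (f (T - s))) \<le> c2"
    proof -
      have "(LINT s|lebesgue_on {0..T}. norm (x s - xd s))
          \<le> (LINT s|lebesgue_on {0..T}. c1 + norm (xd s))"
      proof (rule integral_mono)
        show "integrable (lebesgue_on {0..T}) (\<lambda>s. norm (x s - xd s))"
          by (intro integrable_norm L2_integrable xL)
        show "integrable (lebesgue_on {0..T}) (\<lambda>s. c1 + norm (xd s))"
          by (intro Bochner_Integration.integrable_add integrable_norm L2_integrable xd
              continuous_imp_integrable_real continuous_on_const)
        show "norm (x s - xd s) \<le> c1 + norm (xd s)" if "s \<in> space (lebesgue_on {0..T})" for s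
          using c1[OF bounded_coeff_const A_diss, of s] that norm_triangle_ineq4[of "x s" "xd s"]
          by (simp add: x_def)
      qed
      also have "\<dots> = T * c1 + (LINT s|lebesgue_on {0..T}. norm (xd s))"
      proof -
        have "integrable (lebesgue_on {0..T}) (\<lambda>s. c1)"
          by (intro continuous_imp_integrable_real continuous_on_const)
        then show ?thesis using L2_integrable[OF xd] T by (simp add: measure_restrict_space)
      qed
      finally have tracking: "(LINT s|lebesgue_on {0..T}. norm (x s - xd s))
          \<le> T * c1 + (LINT s|lebesgue_on {0..T}. norm (xd s))" .
      have "(LINT s|lebesgue_on {0..T}. norm (f (T - s))) = (LINT s|lebesgue_on {0..T}. norm (f s))"
        using integral_reflect[OF integrable_norm[OF fi], of T] by simp
      also have "\<dots> \<le> q * (LINT s|lebesgue_on {0..T}. norm (x s - xd s))"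
        unfolding f_def q_def by (rule integral_norm_matrix_le[OF xL])
      also have "\<dots> \<le> q * (T * c1 + (LINT s|lebesgue_on {0..T}. norm (xd s)))"
        by (rule mult_left_mono[OF tracking bqd(2)])
      finally show ?thesis by (simp add: c2_def)
    qed
    obtain \<phi> where \<phi>: "\<phi> 0 = 0" "primitive_on T (\<lambda>s. transpose A *v \<phi> s + f (T - s)) \<phi>"
      using linear_ode_exists[OF T bounded_coeff_const fi'] by metis
    have "\<exists>\<phi>. \<phi> 0 = 0 \<and> primitive_on T (\<lambda>s. transpose (F w (T - s)) *v \<phi> s + f (T - s)) \<phi>" for w
      using linear_ode_exists[OF T F'_coeff fi'] by metis
    then obtain \<phi>h where \<phi>h: "\<And>w. \<phi>h w 0 = 0"
      "\<And>w. primitive_on T (\<lambda>s. transpose (F w (T - s)) *v \<phi>h w s + f (T - s)) (\<phi>h w)" by metis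
    have c2: "norm (\<phi>' s) \<le> c2" if "dissipative_on T G" "\<phi>' 0 = 0" 
        "primitive_on T (\<lambda>s. G s *v \<phi>' s + f (T - s)) \<phi>'" "s \<in> {0..T}" for G \<phi>' s
      using dissipative_bound[OF that(1,3) fi' that(4)] that(2) f_bound by simp
    have c\<phi>: "continuous_on {0..T} \<phi>" by (rule primitive_on_continuous[OF \<phi>(2)])
    have transpose_diff: "transpose X - transpose Y = transpose (X - Y)" for X Y :: "real^'n^'n"
      by (simp add: transpose_def vec_eq_iff)
    have backward: "E (\<lambda>w. (norm (\<phi>h w s - \<phi> s))\<^sup>2) \<le> \<kappa> c2 * h * V" if s: "s \<in> {0..T}" for s
      unfolding \<kappa>_def
    proof (rule random_perturbation_estimate[where G = "\<lambda>w s. transpose (F w (T - s))" and g = "\<lambda>j. transpose (g j)"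
          and D = "transpose A" and \<delta> = \<delta> and x = \<phi>
          and y = "\<lambda>w s. \<phi>h w s - \<phi> s", OF weights T' h F'_diss F'_coeff _ _ c\<phi> _ _ _ _ _ \<delta>0 _ bqd(3) V s])
      fix w assume w: "w \<in> \<Omega>"
      show "primitive_on T (\<lambda>s. transpose (F w (T - s)) *v (\<phi>h w s - \<phi> s)
          + (transpose (F w (T - s)) - transpose A) *v \<phi> s) (\<lambda>s. \<phi>h w s - \<phi> s)"
        by (rule primitive_on_cong[OF primitive_on_diff[OF \<phi>h(2) \<phi>(2)]])
           (simp_all add: matrix_vector_mult_diff_distrib matrix_vector_mult_diff_rdistrib
             del: transpose_matrix_vector)
      show "norm (\<phi> s + (\<phi>h w s - \<phi> s)) \<le> c2" if "s \<in> {0..T}" for s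
        using c2[OF F'_diss[OF w] \<phi>h that] by simp
    next
      fix s assume s: "0 < s" "s < T"
      obtain k where k: "k \<in> {1..K}" "t (k - 1) \<le> T - s" "T - s < t k"
        by (rule time_grid_cell[OF grid, of "T - s"]) (use s in simp_all)
      show "\<exists>k\<in>{1..K}. \<exists>a\<in>{0..s}. s - a \<le> h \<and>
        (\<forall>w\<in>\<Omega>. transpose (F w (T - s)) = transpose (g (w k)) \<and>
           (\<forall>r. a < r \<longrightarrow> r < s \<longrightarrow> transpose (F w (T - r)) = transpose (g (w k))) \<and>
           (\<forall>j\<in>{1..2^M}. \<phi>h (w(k := j)) a - \<phi> a = \<phi>h w a - \<phi> a))"
      proof (rule bexI[OF _ k(1)], rule bexI[of _ "T - t k"], intro conjI ballI allI impI)
        show "s - (T - t k) \<le> h" using spacing[OF k(1)] k(2) by linarith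
        have "t k \<le> t K" by (rule time_grid_mono[OF grid]) (use k(1) in auto)
        then show a: "T - t k \<in> {0..s}" using grid k(3) by (simp add: time_grid_def)
        fix w assume w: "w \<in> \<Omega>"
        show "transpose (F w (T - s)) = transpose (g (w k))" by (simp only: F_cell[OF k])
        show "transpose (F w (T - r)) = transpose (g (w k))" if "T - t k < r" "r < s" for r
          by (subst F_cell[OF k(1)]) (use that k(2) in auto)
        fix j 
        have "\<phi>h w (T - t k) = \<phi>h (w(k := j)) (T - t k)"
          by (rule linear_ode_local[OF F'_diss[OF w] _ \<phi>h(2) \<phi>h(2)])
             (use a s \<phi>h(1) in \<open>auto simp: F_upd\<close>)
        then show "\<phi>h (w(k := j)) (T - t k) - \<phi> (T - t k) = \<phi>h w (T - t k) - \<phi> (T - t k)" by simp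
      qed
    next
      show "(\<Sum>j=1..2^M. p j *\<^sub>R transpose (g j)) = transpose A"
        by (simp add: transpose_sum transpose_scalar flip: mean)
      show "norm ((transpose (g j) - transpose A) *v v) \<le> \<delta> j * norm v" for j v
        unfolding transpose_diff \<delta>_def by (rule norm_transpose_vector_le)
      show "norm (transpose A *v v) \<le> d * norm v" for v
        unfolding d_def by (rule norm_transpose_vector_le)
    qed (use c2[OF A'_diss \<phi>] \<phi>h(1) \<phi>(1) in auto)

    have avg: "E (\<lambda>w. (L2_norm T (\<eta> w))\<^sup>2) \<le> T * (c * h * V)"
      if cont: "\<And>w. continuous_on {0..T} (\<eta> w)" and le: "\<And>s. s \<in> {0..T} \<Longrightarrow> E (\<lambda>w. (norm (\<eta> w s))\<^sup>2) \<le> c * h * V"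
      for \<eta> :: "(nat \<Rightarrow> nat) \<Rightarrow> real \<Rightarrow> real^'n" and c
    proof -
      have i: "integrable (lebesgue_on {0..T}) (\<lambda>s. (norm (\<eta> w s))\<^sup>2)" for w
        by (intro continuous_imp_integrable_real continuous_intros cont)
      have "E (\<lambda>w. (L2_norm T (\<eta> w))\<^sup>2) = (LINT s|lebesgue_on {0..T}. E (\<lambda>w. (norm (\<eta> w s))\<^sup>2))"
        unfolding L2_norm_power2 by (rule E_integral) (rule i)
      also have "\<dots> \<le> (T - 0) * (c * h * V)"
        by (rule integral_le_interior[OF E_integrable[OF i]]) (use le T in auto)
      finally show ?thesis by simp
    qed
    have Eforward: "E (\<lambda>w. (L2_norm T (\<lambda>s. xh w s - x s))\<^sup>2) \<le> T * (\<kappa> c1 * h * V)"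
      by (intro avg forward continuous_on_diff cx primitive_on_continuous[OF xh(2)])
    have Ebackward: "E (\<lambda>w. (L2_norm T (\<lambda>s. \<phi>h w s - \<phi> s))\<^sup>2) \<le> T * (\<kappa> c2 * h * V)"
      by (intro avg backward continuous_on_diff c\<phi> primitive_on_continuous[OF \<phi>h(2)])
    have "E (\<lambda>w. (L2_norm T (\<lambda>s. uh w s - u0 s))\<^sup>2)
       \<le> E (\<lambda>w. 8 * q\<^sup>2 * b\<^sup>2 * T\<^sup>2 / \<alpha>\<^sup>2 * (L2_norm T (\<lambda>s. xh w s - x s))\<^sup>2
            + 2 * b\<^sup>2 / \<alpha>\<^sup>2 * (L2_norm T (\<lambda>s. \<phi>h w s - \<phi> s))\<^sup>2)"
    proof (rule E_mono)
      fix w assume w: "w \<in> \<Omega>"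
      show "(L2_norm T (\<lambda>s. uh w s - u0 s))\<^sup>2
        \<le> 8 * q\<^sup>2 * b\<^sup>2 * T\<^sup>2 / \<alpha>\<^sup>2 * (L2_norm T (\<lambda>s. xh w s - x s))\<^sup>2
            + 2 * b\<^sup>2 / \<alpha>\<^sup>2 * (L2_norm T (\<lambda>s. \<phi>h w s - \<phi> s))\<^sup>2"
        unfolding b_def q_def xh_def
        by (rule control_error[OF T A_diss F_coeff F_diss[OF w] xd symQ symR Q \<alpha>(2,1) u0 _ x_def
              \<phi>(2,1)[unfolded f_def] \<phi>h(2,1)[unfolded f_def]])
           (use uh w in \<open>auto simp: F_def\<close>)
    qed
    also have "\<dots> = 8 * q\<^sup>2 * b\<^sup>2 * T\<^sup>2 / \<alpha>\<^sup>2 * E (\<lambda>w. (L2_norm T (\<lambda>s. xh w s - x s))\<^sup>2)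
        + 2 * b\<^sup>2 / \<alpha>\<^sup>2 * E (\<lambda>w. (L2_norm T (\<lambda>s. \<phi>h w s - \<phi> s))\<^sup>2)"
      by (simp only: E_add E_cmult)
    also have "\<dots> \<le> 8 * q\<^sup>2 * b\<^sup>2 * T\<^sup>2 / \<alpha>\<^sup>2 * (T * (\<kappa> c1 * h * V))
        + 2 * b\<^sup>2 / \<alpha>\<^sup>2 * (T * (\<kappa> c2 * h * V))"
      by (intro add_mono mult_left_mono Eforward Ebackward) auto
    also have "\<dots> = C * h * V" by (simp add: C_def algebra_simps)
    finally show "expect M p K (\<lambda>w. (L2_norm T (\<lambda>s. uh w s - u0 s))\<^sup>2)
       \<le> C * max_spacing K t * splitting_variance M Am S p A"
      by (simp only: h_def V_def)
  qed
qed

end
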